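(* Consider the standard cylinder $Z=\mathbb D^2\times\mathbb R$ over the closed unit disc, as a billiard table in $\mathbb R^3$ with the standard contact structure $\xi_{\mathrm{std}}$ and metric $g_{\mathrm{std}}$. There are no periodic sub-Riemannian billiard orbits in the interior of $Z$. In particular, all the periodic billiard trajectories of $Z$ are of the following form: there are an integer $n\geq 2$, a regular $n$-gon inscribed in $\mathbb D^2$ (a pair of antipodal points if $n=2$) and an integer $m$ coprime to $n$ such that $\gamma$ is the periodic billiard trajectory (unique up to $z$-translation and shift of the parametrisation) for which $\pi\circ\gamma$ is comprised of $n$ circular segments with vertices in the $n$-gon and consecutive vertices of $\pi\circ\gamma$ are obtained by a rotation of angle $\frac{2\pi m}{n}$.
   Context: On $\mathbb R^3$ let $\alpha=dz-\tfrac12(x\,dy-y\,dx)=dz-\tfrac12r^2d\theta$, $\xi_{\mathrm{std}}=\ker\alpha$, and $g_{\mathrm{std}}=dx^2+dy^2$ restricted to $\xi_{\mathrm{std}}$. Write covectors as $\lambda=a\alpha+b\,dx+c\,dy$; the dual norm is $H(\lambda)=\sqrt{b^2+c^2}$ and $S=\{b^2+c^2=1\}$. Geodesics parametrised by arclength are the projections to $\mathbb R^3$ of Hamiltonian orbits of $H$ in $S$; $a$ is constant along them, and with $\pi(x,y,z)=(x,y)$ their projections to the plane are unit-speed circular arcs of signed curvature $a$ (straight segments, counted as circular segments of infinite radius, if $a=0$). A curve tangent to $\xi_{\mathrm{std}}$ is recovered from its projection, up to initial height, by $\Delta z=\int\frac12r^2d\theta$. A billiard trajectory in a table $W\subset\mathbb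 R^3$ is a curve in $W$, parametrised by arclength, consisting of geodesic segments between reflection points on $\partial W$, such that at each reflection point $q$ the ingoing and outgoing momenta $\lambda_{\rm in}\ne\lambda_{\rm out}\in S\cap T_q^*\mathbb R^3$ satisfy $\lambda_{\rm in}-\lambda_{\rm out}\in\mathrm{Ann}(T_q\partial W)$. (For $W=Z$: $a$ is preserved and the planar projection reflects elastically at $\partial\mathbb D^2$.) It is periodic if it is a periodic curve in $\mathbb R^3$ (the period is taken to be minimal when counting segments). *)

theory Defs
  imports "HOL-Analysis.Analysis"
begin

text \<open>
  Points of $\mathbb{R}^3$ and tangent vectors are elements of \<^typ>\<open>real^3\<close>. A covector
  $p_x\,dx + p_y\,dy + p_z\,dz$ is the vector of its components, so that its value on a tangent
  vector is the inner product. The plane is \<^typ>\<open>complex\<close>.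
\<close>

definition contact_form :: "real^3 \<Rightarrow> real^3" where
  "contact_form q = vector [q$2 / 2, - (q$1) / 2, 1]"

definition xi_std :: "real^3 \<Rightarrow> (real^3) set" where
  "xi_std q = {v. contact_form q \<bullet> v = 0}"

definition g_std :: "real^3 \<Rightarrow> real^3 \<Rightarrow> real" where
  "g_std v w = v$1 * w$1 + v$2 * w$2"

text \<open>
  The coefficients of a covector in the coframe $\alpha, dx, dy$ at \<open>q\<close>; see \<open>covector_decomposition\<close>.
\<close>

definition coeff_a :: "real^3 \<Rightarrow> real^3 \<Rightarrow> real" where
  "coeff_a q l = l$3"

definition coeff_b :: "real^3 \<Rightarrow> real^3 \<Rightarrow> real" where
  "coeff_b q l = l$1 - l$3 * q$2 / 2"

definition coeff_c :: "real^3 \<Rightarrow> real^3 \<Rightarrow> real" where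
  "coeff_c q l = l$2 + l$3 * q$1 / 2"

lemma covector_decomposition:
  "l = a *\<^sub>R contact_form q + b *\<^sub>R axis 1 1 + c *\<^sub>R axis 2 1
     \<longleftrightarrow> a = coeff_a q l \<and> b = coeff_b q l \<and> c = coeff_c q l"
  by (auto simp: vec_eq_iff forall_3 contact_form_def coeff_a_def coeff_b_def coeff_c_def
        axis_def algebra_simps)

text \<open>The Hamiltonian on $T^*\mathbb{R}^3$, with arguments (base point, covector).\<close>

definition dual_norm :: "(real^3) \<times> (real^3) \<Rightarrow> real" where
  "dual_norm = (\<lambda>(q, l). sqrt ((coeff_b q l)\<^sup>2 + (coeff_c q l)\<^sup>2))"

lemma dual_norm_eq_Sup:
  "dual_norm (q, l) = Sup {l \<bullet> v | v. v \<in> xi_std q \<and> g_std v v \<le> 1}"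
proof -
  let ?b = "coeff_b q l" and ?c = "coeff_c q l"
  let ?N = "sqrt (?b\<^sup>2 + ?c\<^sup>2)"
  have pairing: "l \<bullet> v = ?b * v$1 + ?c * v$2" if "v \<in> xi_std q" for v
  proof -
    have "v$3 = (q$1 * v$2 - q$2 * v$1) / 2"
      using that by (auto simp: xi_std_def contact_form_def inner_vec_def sum_3 field_simps)
    then show ?thesis
      by (simp only: inner_vec_def sum_3 inner_real_def coeff_b_def coeff_c_def)
        (simp add: field_simps)
  qed
  have upper: "l \<bullet> v \<le> ?N" if v: "v \<in> xi_std q" "g_std v v \<le> 1" for v
  proof -
    have "l \<bullet> v = (?b, ?c) \<bullet> (v$1, v$2)"
      using pairing[OF v(1)] by (simp add: inner_prod_def)
    also have "\<dots> \<le> norm (?b, ?c) * norm (v$1, v$2)"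
      by (rule norm_cauchy_schwarz)
    also have "\<dots> \<le> norm (?b, ?c) * 1"
      using v(2) by (intro mult_left_mono) (auto simp: norm_Pair g_std_def power2_eq_square)
    finally show ?thesis by (simp add: norm_Pair)
  qed
  have "\<exists>v. v \<in> xi_std q \<and> g_std v v \<le> 1 \<and> l \<bullet> v = ?N"
  proof -
    define v :: "real^3" where
      "v = vector [?b / ?N, ?c / ?N, (q$1 * (?c / ?N) - q$2 * (?b / ?N)) / 2]"
    have xi: "v \<in> xi_std q"
      by (simp add: v_def xi_std_def contact_form_def inner_vec_def sum_3 field_simps)
    have N2: "?N * ?N = ?b * ?b + ?c * ?c"
      by (simp add: power2_eq_square)
    have "g_std v v = (?b * ?b + ?c * ?c) / (?N * ?N)"
      by (simp only: g_std_def v_def vector_3 add_divide_distrib times_divide_times_eq)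
    then have "g_std v v \<le> 1"
      by (simp only: N2) simp
    moreover have "l \<bullet> v = ?N * ?N / ?N"
      unfolding N2 pairing[OF xi]
      by (simp only: v_def vector_3 add_divide_distrib times_divide_eq_right)
    then have "l \<bullet> v = ?N"
      by (metis div_by_0 nonzero_mult_div_cancel_left)
    ultimately show ?thesis
      using xi by blast
  qed
  then show ?thesis
    unfolding dual_norm_def prod.case
    by (intro cSup_eq_maximum[symmetric]) (use upper in \<open>force+\<close>)
qed

text \<open>
  Hamilton's equations at time \<open>t\<close> for the curve $(q,p)$ and the canonical symplectic form:
  $dH(u,v) = \dot q\cdot v - \dot p\cdot u$, that is $\dot q = \partial H/\partial p$ and
  $\dot p = -\partial H/\partial q$.
\<close>

definition hamilton_eq_at ::
  "('a::real_inner \<times> 'a \<Rightarrow> real) \<Rightarrow> (real \<Rightarrow> 'a) \<Rightarrow> (real \<Rightarrow> 'a) \<Rightarrow> real \<Rightarrow> bool" where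
  "hamilton_eq_at H q p t \<longleftrightarrow> (\<exists>q' p'.
     (q has_vector_derivative q') (at t) \<and> (p has_vector_derivative p') (at t) \<and>
     (H has_derivative (\<lambda>(u, v). q' \<bullet> v - p' \<bullet> u)) (at (q t, p t)))"

text \<open>Velocities of curves in \<open>M\<close>; for a smooth submanifold this is the tangent space.\<close>

definition tangent_space_at :: "'a::real_normed_vector set \<Rightarrow> 'a \<Rightarrow> 'a set" where
  "tangent_space_at M q = {v. \<exists>c. c 0 = q \<and> (\<forall>\<^sub>F t in nhds 0. c t \<in> M) \<and>
     (c has_vector_derivative v) (at (0::real))}"

definition annihilator :: "'a::real_inner set \<Rightarrow> 'a set" where
  "annihilator V = {l. \<forall>v\<in>V. l \<bullet> v = 0}"

text \<open>
  \<open>R\<close> is the set of reflection times and \<open>p\<close> the momentum, whose values at times in \<open>R\<close> are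
  irrelevant. Off \<open>R\<close> the pair $(\gamma, p)$ is a Hamiltonian orbit of \<open>dual_norm\<close> in the unit
  level $S$; local finiteness of \<open>R\<close> makes $\gamma$ a concatenation of geodesic segments.
\<close>

definition billiard_trajectory_with ::
  "(real^3) set \<Rightarrow> real set \<Rightarrow> (real \<Rightarrow> real^3) \<Rightarrow> bool" where
  "billiard_trajectory_with W R \<gamma> \<longleftrightarrow>
     continuous_on UNIV \<gamma> \<and> range \<gamma> \<subseteq> W \<and>
     (\<forall>s t. finite (R \<inter> {s..t})) \<and>
     (\<exists>p.
       (\<forall>t. t \<notin> R \<longrightarrow> dual_norm (\<gamma> t, p t) = 1 \<and> hamilton_eq_at dual_norm \<gamma> p t) \<and>
       (\<forall>t\<in>R. \<gamma> t \<in> frontier W \<and>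
         (\<exists>l_in l_out.
           (p \<longlongrightarrow> l_in) (at_left t) \<and> (p \<longlongrightarrow> l_out) (at_right t) \<and>
           dual_norm (\<gamma> t, l_in) = 1 \<and> dual_norm (\<gamma> t, l_out) = 1 \<and> l_in \<noteq> l_out \<and>
           l_in - l_out \<in> annihilator (tangent_space_at (frontier W) (\<gamma> t)))))"

definition billiard_trajectory :: "(real^3) set \<Rightarrow> (real \<Rightarrow> real^3) \<Rightarrow> bool" where
  "billiard_trajectory W \<gamma> \<longleftrightarrow> (\<exists>R. billiard_trajectory_with W R \<gamma>)"

definition is_period :: "(real \<Rightarrow> 'a) \<Rightarrow> real \<Rightarrow> bool" where
  "is_period \<gamma> T \<longleftrightarrow> T > 0 \<and> (\<forall>t. \<gamma> (t + T) = \<gamma> t)"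

definition is_minimal_period :: "(real \<Rightarrow> 'a) \<Rightarrow> real \<Rightarrow> bool" where
  "is_minimal_period \<gamma> T \<longleftrightarrow> is_period \<gamma> T \<and> (\<forall>T'. is_period \<gamma> T' \<longrightarrow> T \<le> T')"

definition periodic_billiard_trajectory :: "(real^3) set \<Rightarrow> (real \<Rightarrow> real^3) \<Rightarrow> bool" where
  "periodic_billiard_trajectory W \<gamma> \<longleftrightarrow> billiard_trajectory W \<gamma> \<and> (\<exists>T. is_period \<gamma> T)"

definition plane_proj :: "real^3 \<Rightarrow> complex" where
  "plane_proj q = Complex (q$1) (q$2)"

definition std_cylinder :: "(real^3) set" where
  "std_cylinder = {q. plane_proj q \<in> cball 0 1}"

text \<open>For \<open>n = 2\<close> this is a pair of antipodal points.\<close>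

definition inscribed_regular_ngon :: "nat \<Rightarrow> complex set \<Rightarrow> bool" where
  "inscribed_regular_ngon n P \<longleftrightarrow>
     (\<exists>w. norm w = 1 \<and> P = (\<lambda>k. w * cis (2 * pi * real k / real n)) ` {..<n})"

text \<open>Unit speed and constant signed curvature \<open>a\<close>; straight if \<open>a = 0\<close>.\<close>

definition circular_segment :: "(real \<Rightarrow> complex) \<Rightarrow> real \<Rightarrow> real \<Rightarrow> bool" where
  "circular_segment c s t \<longleftrightarrow> (\<exists>a v. norm v = 1 \<and>
     (\<forall>u\<in>{s..t}. (c has_vector_derivative v * cis (a * (u - s))) (at u within {s..t})))"

text \<open>
  The sequence \<open>\<tau>\<close> enumerates the reflection times in increasing order; a minimal period contains
  \<open>n\<close> of them, so that the projected closed curve consists of \<open>n\<close> circular segments, with vertices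
  the projected reflection points.
\<close>

definition ngon_trajectory :: "nat \<Rightarrow> complex set \<Rightarrow> int \<Rightarrow> (real \<Rightarrow> real^3) \<Rightarrow> bool" where
  "ngon_trajectory n P m \<gamma> \<longleftrightarrow> (\<exists>\<tau> :: int \<Rightarrow> real. \<exists>T.
     strict_mono \<tau> \<and> billiard_trajectory_with std_cylinder (range \<tau>) \<gamma> \<and>
     is_minimal_period \<gamma> T \<and> (\<forall>k. \<tau> (k + int n) = \<tau> k + T) \<and>
     (\<forall>k. circular_segment (plane_proj \<circ> \<gamma>) (\<tau> k) (\<tau> (k + 1)) \<and>
          plane_proj (\<gamma> (\<tau> k)) \<in> P \<and>
          plane_proj (\<gamma> (\<tau> (k + 1))) = cis (2 * pi * real_of_int m / real n) * plane_proj (\<gamma> (\<tau> k))))"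

definition same_up_to_z_translation_and_shift ::
  "(real \<Rightarrow> real^3) \<Rightarrow> (real \<Rightarrow> real^3) \<Rightarrow> bool" where
  "same_up_to_z_translation_and_shift \<gamma> \<delta> \<longleftrightarrow>
     (\<exists>s h. \<forall>t. \<delta> t = \<gamma> (t + s) + h *\<^sub>R axis 3 1)"

end

theory Submission
  imports Defs "HOL-Real_Asymp.Real_Asymp"
begin

text \<open>
  The curvature $a$ is conserved by reflections, and every planar circular segment leaves and meets the
  unit circle at the same angle. Hence a trajectory with one reflection repeats a single arc: after
  rotation to the starting point $1$ it is \<open>1 + u * unit_arc a s\<close> for \<open>0 \<le> s \<le> L\<close>, its length
  \<open>L\<close> is determined by \<open>a\<close> and the departure direction \<open>u\<close>, and each step rotates by its end point
  $\rho$. Periodicity forces $\rho$ to be a root of unity, different from $1$ because the arc is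
  transversal to the circle, and forces the height gained along the arc, which is the area it sweeps
  around the origin, to vanish. Without reflections the projection is a full circle, which sweeps a
  nonzero area. Conversely, among the arcs in the disc from $1$ to \<open>cis (2 * \<theta>)\<close> exactly one
  sweeps area zero: in terms of the half angle $x = a L / 2$ the condition reads
  $(x - \sin x \cos x) / \sin^2 x = - \cot \theta$, whose left side is strictly increasing on $(-\pi, \pi)$.
\<close>

section \<open>Circular arcs in the unit disc\<close>

text \<open>Two clauses of \<open>chord\<close> work together: staying in the disc and meeting the
  circle transversally force the velocity at the end to point outward, so no other time can be an
  end. This replaces explicit formulas for the length and treats straight segments and circles
  alike. The area swept about the origin splits into a triangle and a circular segment. Twice the
  triangle with vertices 0, 1 and \<open>cis (2 * \<theta>)\<close> is
  \<open>sin (2 * \<theta>)\<close>; the segment lies over a chord of length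
  \<open>2 * sin \<theta>\<close>. Dividing by \<open>2 * (sin \<theta>)\<^sup>2\<close> yields the
  equation for the half angle. The obstacle in the periodic case is that the reflection times are
  only given as some set \<open>R\<close>, while periodicity is assumed for the curve alone. They
  are recovered as the times at which the planar projection is not differentiable, so that every
  period of the curve permutes them; this also settles the minimal period. Reflections are followed
  forward in time only, and negative times are reached through periodicity.\<close>

text \<open>The antiderivative of \<open>\<lambda>t. cis (a * t)\<close> vanishing at \<open>0\<close>.\<close>

definition unit_arc :: "real \<Rightarrow> real \<Rightarrow> complex" where
  "unit_arc a t = (if a = 0 then of_real t else (cis (a * t) - 1) / (\<i> * of_real a))"

text \<open>The signed distance from the start to the point at time \<open>t\<close>; see \<open>unit_arc_eq_chord\<close>.\<close>

definition arc_chord :: "real \<Rightarrow> real \<Rightarrow> real" where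
  "arc_chord a t = (if a = 0 then t else 2 * sin (a * t / 2) / a)"

text \<open>Twice the area between the arc and its chord.\<close>

definition arc_lift :: "real \<Rightarrow> real \<Rightarrow> real" where
  "arc_lift a t = (if a = 0 then 0 else (a * t - sin (a * t)) / a\<^sup>2)"

lemma unit_arc_0 [simp]: "unit_arc a 0 = 0"
  by (simp add: unit_arc_def)

lemma arc_lift_0 [simp]: "arc_lift a 0 = 0"
  by (simp add: arc_lift_def)

lemma has_vector_derivative_cis_mult:
  "((\<lambda>t. cis (a * (t - s))) has_vector_derivative \<i> * of_real a * cis (a * (t - s))) (at t within A)"
  unfolding has_vector_derivative_def
  by (rule derivative_eq_intros refl | simp add: fun_eq_iff scaleR_conv_of_real algebra_simps)+

text \<open>A chord makes half of the total turning angle with the initial tangent. Algebraically,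
  \<open>cis x\<close> with \<open>x = a * t / 2\<close> is factored out of
  \<open>cis (2 * x) - 1\<close>, which leaves \<open>cis x - cis (- x)\<close>.\<close>

lemma unit_arc_eq_chord: "unit_arc a t = cis (a * t / 2) * of_real (arc_chord a t)"
proof (cases "a = 0")
  case False
  define x where "x = a * t / 2"
  have "cis (a * t) - 1 = cis x * (2 * \<i> * of_real (sin x))"
  proof -
    have "cis (a * t) = cis x * cis x"
      by (simp add: cis_mult x_def)
    moreover have "1 = cis x * cis (- x)" by (simp add: cis_mult)
    moreover have "cis x - cis (-x) = 2 * \<i> * of_real (sin x)"
      by (simp add: complex_eq_iff)
    ultimately show ?thesis by (metis right_diff_distrib)
  qed
  then show ?thesis
    using False by (simp add: unit_arc_def arc_chord_def x_def field_simps)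
qed (simp add: unit_arc_def arc_chord_def)

lemma has_vector_derivative_arc:
  "((\<lambda>t. unit_arc a (t - s)) has_vector_derivative cis (a * (t - s))) (at t within A)"
proof (cases "a = 0")
  case True
  then show ?thesis
    by (auto simp: unit_arc_def scaleR_conv_of_real intro!: derivative_eq_intros)
next
  case False
  have "((\<lambda>t. (1 / (\<i> * of_real a)) * (cis (a * (t - s)) - 1)) has_vector_derivative
     (1 / (\<i> * of_real a)) * (\<i> * of_real a * cis (a * (t - s)) - 0)) (at t within A)"
    by (intro derivative_intros has_vector_derivative_mult_right has_vector_derivative_cis_mult)
  then show ?thesis using False by (simp add: unit_arc_def[abs_def])
qed

lemma continuous_on_unit_arc [continuous_intros]:
  "continuous_on A f \<Longrightarrow> continuous_on A (\<lambda>x. unit_arc a (f x))"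
  unfolding unit_arc_def by (cases "a = 0") (auto intro!: continuous_intros)

text \<open>For a planar curve p the quantity Im (cnj p * p') is r^2 d\<theta>/dt, twice the areal
  velocity about the origin. Here p is the arc seen from its own start, so \<open>arc_lift\<close>
  is the area it sweeps about that point, doubled.\<close>

lemma has_real_derivative_arc_lift:
  "((\<lambda>t. arc_lift a (t - s)) has_real_derivative Im (cnj (unit_arc a (t - s)) * cis (a * (t - s)))) (at t within A)"
proof (cases "a = 0")
  case True
  then show ?thesis by (simp add: arc_lift_def[abs_def] unit_arc_def)
next
  case False
  have e: "Im (cnj (unit_arc a (t - s)) * cis (a * (t - s))) = (1 - cos (a * (t - s))) / a"
  proof -
    let ?x = "a * (t - s)"
    have "Re (unit_arc a (t - s)) = sin ?x / a" "Im (unit_arc a (t - s)) = (1 - cos ?x) / a"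
      using False by (auto simp: unit_arc_def Re_divide Im_divide power2_eq_square minus_divide_left)
    then have "Im (cnj (unit_arc a (t - s)) * cis ?x) = (sin ?x * sin ?x - (1 - cos ?x) * cos ?x) / a"
      by (simp add: diff_divide_distrib left_diff_distrib)
    also have "sin ?x * sin ?x - (1 - cos ?x) * cos ?x = 1 - cos ?x"
      using sin_cos_squared_add[of ?x] by (simp add: left_diff_distrib power2_eq_square)
    finally show ?thesis .
  qed
  show ?thesis
    unfolding e using False
    by (auto simp: arc_lift_def[abs_def] diff_divide_distrib power2_eq_square intro!: derivative_eq_intros)
qed

lemma norm_unit_arc_le: "a \<noteq> 0 \<Longrightarrow> norm (unit_arc a t) \<le> 2 / \<bar>a\<bar>"
  using norm_triangle_ineq4[of "cis (a*t)" 1] by (simp add: unit_arc_def norm_divide norm_mult divide_right_mono)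

lemma arc_full_turn: "a \<noteq> 0 \<Longrightarrow> unit_arc a (2 * pi / \<bar>a\<bar>) = 0"
  by (cases "a > 0") (auto simp: unit_arc_def simp flip: cis_cnj)

text \<open>
  Started at \<open>1\<close> in the inward direction \<open>u\<close>, the arc of curvature \<open>a\<close> stays in the unit disc up to
  time \<open>L\<close>, when it meets the unit circle transversally.
\<close>

definition chord :: "real \<Rightarrow> complex \<Rightarrow> real \<Rightarrow> bool" where
  "chord a u L \<longleftrightarrow> norm u = 1 \<and> Re u < 0 \<and> L > 0 \<and> norm (1 + u * unit_arc a L) = 1 \<and>
     Re (cnj (1 + u * unit_arc a L) * (u * cis (a * L))) \<noteq> 0 \<and>
     (\<forall>s\<in>{0..L}. norm (1 + u * unit_arc a s) \<le> 1)"

section \<open>Length, end point and reflection of a chord\<close>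

lemma has_real_derivative_norm_power2:
  fixes c :: "real \<Rightarrow> complex"
  assumes "(c has_vector_derivative w) (at t within A)"
  shows "((\<lambda>t. (norm (c t))\<^sup>2) has_real_derivative 2 * Re (cnj (c t) * w)) (at t within A)"
proof -
  have "((\<lambda>t. Re (c t)) has_real_derivative Re w) (at t within A)"
    "((\<lambda>t. Im (c t)) has_real_derivative Im w) (at t within A)"
    unfolding has_real_derivative_iff_has_vector_derivative
    using bounded_linear.has_vector_derivative[OF bounded_linear_Re assms]
      bounded_linear.has_vector_derivative[OF bounded_linear_Im assms] .
  from DERIV_add[OF DERIV_power[OF this(1), of 2] DERIV_power[OF this(2), of 2]]
  show ?thesis by (simp add: cmod_power2 algebra_simps)
qed

lemma has_real_derivative_norm_arc:
  "((\<lambda>s. (norm (1 + u * unit_arc a s))\<^sup>2) has_real_derivative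
     2 * Re (cnj (1 + u * unit_arc a s) * (u * cis (a * s)))) (at s within A)"
proof (rule has_real_derivative_norm_power2)
  have "((\<lambda>s. 1 + u * unit_arc a (s - 0)) has_vector_derivative 0 + u * cis (a * (s - 0))) (at s within A)"
    by (intro derivative_intros has_vector_derivative_mult_right has_vector_derivative_arc)
  then show "((\<lambda>s. 1 + u * unit_arc a s) has_vector_derivative u * cis (a * s)) (at s within A)"
    by simp
qed

text \<open>After a full turn the arc would return to \<open>1\<close> from outside the disc.\<close>

lemma chord_less_full_turn:
  assumes "norm u = 1" "Re u < 0" "L > 0" "\<And>s. 0 \<le> s \<Longrightarrow> s \<le> L \<Longrightarrow> norm (1 + u * unit_arc a s) \<le> 1"
  shows "\<bar>a\<bar> * L < 2 * pi"
proof (rule ccontr)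
  assume "\<not> ?thesis"
  then have ge: "2 * pi \<le> \<bar>a\<bar> * L" by simp
  then have a: "a \<noteq> 0" using pi_gt_zero by (intro notI) (simp del: pi_gt_zero)
  define P where "P = 2 * pi / \<bar>a\<bar>"
  have P: "0 < P" "P \<le> L" using ge a by (auto simp: P_def field_simps)
  have "unit_arc a P = 0" using arc_full_turn[OF a] P_def by simp
  moreover have "cis (a * P) = 1"
    using a by (cases "a > 0") (auto simp: P_def complex_eq_iff)
  ultimately have "((\<lambda>s. (norm (1 + u * unit_arc a s))\<^sup>2) has_real_derivative 2 * Re u) (at P)"
    using has_real_derivative_norm_arc[of u a P UNIV] by simp
  from DERIV_neg_dec_left[OF this] assms(2) obtain d where d: "d > 0"
    "\<And>h. h > 0 \<Longrightarrow> h < d \<Longrightarrow> (norm (1 + u * unit_arc a P))\<^sup>2 < (norm (1 + u * unit_arc a (P - h)))\<^sup>2"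
    by auto
  define h where "h = min (d / 2) P"
  have "h > 0" "h < d" "h \<le> P" using d P by (auto simp: h_def)
  then have "1 < (norm (1 + u * unit_arc a (P - h)))\<^sup>2" using d(2) \<open>unit_arc a P = 0\<close> by fastforce
  moreover have "norm (1 + u * unit_arc a (P - h)) \<le> 1"
    using assms(4) \<open>h > 0\<close> \<open>h \<le> P\<close> P by simp
  ultimately show False
    by (simp add: abs_square_le_1 not_le[symmetric])
qed

text \<open>Transversality excludes radial speed zero, and a negative radial speed would mean that
  the arc was outside the disc just before \<open>L\<close>.\<close>

lemma chord_end_outward:
  assumes "chord a u L"
  shows "Re (cnj (1 + u * unit_arc a L) * (u * cis (a * L))) > 0"
proof (rule ccontr)
  assume "\<not> ?thesis"
  then have "2 * Re (cnj (1 + u * unit_arc a L) * (u * cis (a * L))) < 0"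
    using assms unfolding chord_def by linarith
  from DERIV_neg_dec_left[OF has_real_derivative_norm_arc this] assms obtain d where d: "d > 0"
    "\<And>h. h > 0 \<Longrightarrow> h < d \<Longrightarrow> 1 < (norm (1 + u * unit_arc a (L - h)))\<^sup>2"
    by (auto simp: chord_def)
  define h where "h = min (d / 2) L"
  have "h > 0" "h < d" "h \<le> L" using d assms by (auto simp: h_def chord_def)
  then have "1 < (norm (1 + u * unit_arc a (L - h)))\<^sup>2" using d(2) by fastforce
  moreover have "norm (1 + u * unit_arc a (L - h)) \<le> 1"
    using assms \<open>h > 0\<close> \<open>h \<le> L\<close> by (simp add: chord_def)
  ultimately show False
    by (simp add: abs_square_le_1 not_le[symmetric])
qed

text \<open>The velocity at the end points outward, so a longer chord with the same data would be
  outside the disc just after the shorter one ends.\<close>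

lemma chord_length_unique:
  assumes "chord a u L" "chord a u L'"
  shows "L = L'"
proof -
  have False if "chord a u L" "chord a u L'" "L < L'" for L L'
  proof -
    have "2 * Re (cnj (1 + u * unit_arc a L) * (u * cis (a * L))) > 0"
      using chord_end_outward[OF that(1)] by simp
    from DERIV_pos_inc_right[OF has_real_derivative_norm_arc this] that obtain d where d: "d > 0"
      "\<And>h. h > 0 \<Longrightarrow> h < d \<Longrightarrow> 1 < (norm (1 + u * unit_arc a (L + h)))\<^sup>2"
      by (auto simp: chord_def)
    define h where "h = min (d / 2) (L' - L)"
    have "h > 0" "h < d" "h \<le> L' - L" using d that by (auto simp: h_def)
    then have "1 < (norm (1 + u * unit_arc a (L + h)))\<^sup>2" using d(2) by fastforce
    moreover have "norm (1 + u * unit_arc a (L + h)) \<le> 1"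
      using that \<open>h > 0\<close> \<open>h \<le> L' - L\<close> by (simp add: chord_def)
    ultimately show False
      by (simp add: abs_square_le_1 not_le[symmetric])
  qed
  then show ?thesis using assms by (meson linorder_neqE)
qed

text \<open>Less than a full turn means that the half angle \<open>a * L / 2\<close> has absolute
  value below \<open>pi\<close>, where its sine has the sign of \<open>a\<close>.\<close>

lemma chord_arc_chord_pos:
  assumes "chord a u L"
  shows "arc_chord a L > 0"
proof -
  have lt: "\<bar>a\<bar> * L < 2 * pi" and L: "L > 0"
    using assms chord_less_full_turn[of u L a] by (auto simp: chord_def)
  show ?thesis
  proof (cases a "0::real" rule: linorder_cases)
    case less
    have "sin (- (a * L / 2)) > 0"
      by (rule sin_gt_zero) (use less L lt in \<open>auto simp: mult_neg_pos\<close>)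
    then show ?thesis using less by (simp add: arc_chord_def zero_less_divide_iff)
  next
    case greater
    have "sin (a * L / 2) > 0"
      by (rule sin_gt_zero) (use greater L lt in auto)
    then show ?thesis using greater by (simp add: arc_chord_def)
  qed (use L in \<open>simp add: arc_chord_def\<close>)
qed

lemma unit_mult_cnj: "norm (z::complex) = 1 \<Longrightarrow> z * cnj z = 1"
  by (simp add: complex_norm_square[symmetric])

text \<open>Let d be the direction of the chord and \<sigma> its length. If 1 and 1 + d \<sigma>
  both lie on the unit circle and \<sigma> is nonzero, then \<sigma> = - d - cnj d, and the end
  point is - d^2. The direction d is \<open>u\<close> turned by half the angle of the arc.\<close>

lemma chord_end_eq:
  assumes "chord a u L"
  shows "1 + u * unit_arc a L = - (u\<^sup>2 * cis (a * L))"
proof -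
  define d where "d = u * cis (a * L / 2)"
  define \<sigma> where "\<sigma> = complex_of_real (arc_chord a L)"
  define e where "e = 1 + u * unit_arc a L"
  have \<sigma>: "\<sigma> \<noteq> 0" "cnj \<sigma> = \<sigma>"
    using chord_arc_chord_pos[OF assms] by (auto simp: \<sigma>_def)
  have e: "e * cnj e = 1" using assms by (intro unit_mult_cnj) (simp add: chord_def e_def)
  have d: "d * cnj d = 1" using assms by (intro unit_mult_cnj) (simp add: chord_def d_def norm_mult)
  have ed: "e = 1 + d * \<sigma>" by (simp add: e_def d_def \<sigma>_def unit_arc_eq_chord)
  have "cnj e = 1 + cnj d * \<sigma>" using \<sigma> by (simp add: ed)
  then have "(1 + d * \<sigma>) * (1 + cnj d * \<sigma>) = 1" using e ed by (metis)
  then have "\<sigma> * (d + cnj d + d * cnj d * \<sigma>) = 0" by (simp add: algebra_simps)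
  then have "d + cnj d + \<sigma> = 0" using \<sigma> d by simp
  then have "\<sigma> = - d - cnj d" by (metis add_eq_0_iff minus_add_distrib diff_conv_add_uminus)
  then have "e = 1 + d * (- d - cnj d)" using ed by blast
  then have "e = - d\<^sup>2" using d by (simp add: algebra_simps power2_eq_square)
  also have "d\<^sup>2 = u\<^sup>2 * cis (a * L)" by (simp add: d_def power2_eq_square mult_ac flip: cis_mult[of "a * L / 2" "a * L / 2", simplified])
  finally show ?thesis by (simp add: e_def)
qed

lemma chord_end_neq_1:
  assumes "chord a u L"
  shows "1 + u * unit_arc a L \<noteq> 1"
  using chord_arc_chord_pos[OF assms] assms by (auto simp: unit_arc_eq_chord chord_def)

text \<open>The map sending v to - e^2 cnj v reflects in the tangent line of the circle at
  \<open>e\<close>. Applied to the arrival velocity it returns the departure velocity rotated by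
  \<open>e\<close>, so the next arc is the same arc rotated. With \<open>chord_end_eq\<close> this
  reduces to \<open>e * cnj (u * cis (a * L)) = - u\<close>.\<close>

lemma chord_reflect:
  assumes "chord a u L" and "e = 1 + u * unit_arc a L"
  shows "- (e\<^sup>2 * cnj (u * cis (a * L))) = e * u"
proof -
  have "cnj u * u = 1" using assms by (simp add: unit_mult_cnj mult.commute chord_def)
  moreover have "cnj (cis (a * L)) * cis (a * L) = 1" by (simp add: cis_cnj cis_mult)
  moreover have "e = - (u\<^sup>2 * cis (a * L))" using assms chord_end_eq by blast
  moreover have "e * cnj (u * cis (a * L)) = - (u * (cnj u * u) * (cnj (cis (a * L)) * cis (a * L)))"
    if "e = - (u\<^sup>2 * cis (a * L))"
    by (simp only: that complex_cnj_mult) (simp add: power2_eq_square)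
  ultimately have "e * cnj (u * cis (a * L)) = - u" by simp
  then have "e * (e * cnj (u * cis (a * L))) = e * - u" by simp
  then show ?thesis by (simp add: power2_eq_square mult.assoc)
qed

section \<open>Arcs sweeping area zero\<close>

text \<open>
  The area between a chord of length \<open>2\<close> and the arc of half angle \<open>x\<close> over it; the value \<open>0\<close>
  at \<open>x = 0\<close> is the limit.
\<close>

definition area_ratio :: "real \<Rightarrow> real" where
  "area_ratio x = (if x = 0 then 0 else (x - sin x * cos x) / (sin x)\<^sup>2)"

lemma area_ratio_minus: "area_ratio (- x) = - area_ratio x"
  by (simp add: area_ratio_def minus_divide_left)

text \<open>The difference of the two sides vanishes at 0 and has derivative
  \<open>z * sin z\<close>. It is the factor that decides the sign of the derivative of
  \<open>area_ratio\<close>.\<close>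

lemma mult_cos_less_sin:
  assumes "0 < x" "x < pi"
  shows "x * cos x < sin x"
proof -
  have "sin 0 - 0 * cos 0 < sin x - x * cos x"
  proof (rule DERIV_pos_imp_increasing_open[OF assms(1)])
    show "\<exists>y. ((\<lambda>x. sin x - x * cos x) has_real_derivative y) (at z) \<and> 0 < y" if "0 < z" "z < x" for z
      using that assms sin_gt_zero[of z]
      by (intro exI[of _ "z * sin z"] conjI) (auto intro!: derivative_eq_intros)
  qed (intro continuous_intros)
  then show ?thesis by simp
qed

lemma area_ratio_pos:
  assumes "0 < x" "x < pi"
  shows "area_ratio x > 0"
proof -
  have s: "sin x > 0" using assms by (intro sin_gt_zero)
  have "sin x * cos x < sin x * 1"
    using cos_monotone_0_pi[of 0 x] s assms by (intro mult_strict_left_mono) auto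
  also have "\<dots> \<le> x" using sin_x_le_x[of x] assms by simp
  finally show ?thesis using assms s by (simp add: area_ratio_def)
qed

lemma area_ratio_less_pos:
  assumes "0 < x" "x < y" "y < pi"
  shows "area_ratio x < area_ratio y"
proof -
  let ?f = "\<lambda>x. (x - sin x * cos x) / (sin x)\<^sup>2 :: real"
  have D: "(?f has_real_derivative 2 * (sin z - z * cos z) / sin z ^ 3) (at z)" if "sin z > 0" for z
  proof -
    have cc: "cos z * cos z = 1 - sin z * sin z"
      using sin_cos_squared_add[of z] by (simp add: power2_eq_square)
    \<comment> \<open>The left side keeps the shape of the numerator delivered by the quotient rule;
      one factor \<open>sin z\<close> then cancels against the denominator.\<close>
    have e: "((1 - (cos z * cos z + - sin z * sin z)) * (sin z)\<^sup>2 - (z - sin z * cos z) * (2 * (cos z * sin z)))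
        = 2 * sin z * (sin z - z * cos z)"
      unfolding power2_eq_square using cc by algebra
    have "(?f has_real_derivative ((1 - (cos z * cos z + - sin z * sin z)) * (sin z)\<^sup>2 - (z - sin z * cos z) * (2 * (cos z * sin z)))
        / ((sin z)\<^sup>2 * (sin z)\<^sup>2)) (at z)"
      using that by (auto intro!: derivative_eq_intros simp: algebra_simps)
    then show ?thesis unfolding e
      by (rule DERIV_cong) (use that in \<open>simp add: field_simps power2_eq_square power3_eq_cube\<close>)
  qed
  have s: "sin z > 0" if "x \<le> z" "z \<le> y" for z
    using that assms by (intro sin_gt_zero) auto
  have "?f x < ?f y"
  proof (rule DERIV_pos_imp_increasing[OF assms(2)])
    fix z assume z: "x \<le> z" "z \<le> y"
    have "z * cos z < sin z" using z assms by (intro mult_cos_less_sin) auto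
    then show "\<exists>d. (?f has_real_derivative d) (at z) \<and> 0 < d"
      using D[OF s[OF z]] s[OF z] by (intro exI[of _ "2 * (sin z - z * cos z) / sin z ^ 3"] conjI) auto
  qed
  then show ?thesis using assms by (simp add: area_ratio_def)
qed

text \<open>Two positive arguments are covered by the derivative, two negative ones by oddness, and
  arguments on both sides of 0 by the signs of the values.\<close>

lemma area_ratio_less:
  assumes "- pi < x" "x < y" "y < pi"
  shows "area_ratio x < area_ratio y"
proof -
  have 0: "area_ratio 0 = 0" by (simp add: area_ratio_def)
  consider "0 < x" | "y < 0" | "x \<le> 0" "0 \<le> y" by linarith
  then show ?thesis
  proof cases
    case 1 then show ?thesis using assms area_ratio_less_pos by blast
  next
    case 2 then show ?thesis
      using assms area_ratio_less_pos[of "- y" "- x"] by (simp add: area_ratio_minus)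
  next
    case 3
    then have "area_ratio x \<le> 0" "area_ratio y \<ge> 0"
      "area_ratio x < 0 \<or> area_ratio y > 0"
      using assms area_ratio_pos[of "- x"] area_ratio_pos[of y] 0
      by (force simp: area_ratio_minus order.order_iff_strict)+
    then show ?thesis by linarith
  qed
qed

text \<open>On this interval the denominator vanishes only at 0. There the numerator behaves like
  (2/3) x^3 and the denominator like x^2, so the limit agrees with the value 0.\<close>

lemma isCont_area_ratio:
  assumes "- pi < x" "x < pi"
  shows "isCont area_ratio x"
proof (cases "x = 0")
  case True
  have "((\<lambda>x. (x - sin x * cos x) / (sin x)\<^sup>2 :: real) \<longlongrightarrow> 0) (at 0)"
    by real_asymp
  moreover have "eventually (\<lambda>x. (x - sin x * cos x) / (sin x)\<^sup>2 = area_ratio x) (at 0)"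
    by (auto simp: area_ratio_def eventually_at_filter)
  ultimately have "(area_ratio \<longlongrightarrow> 0) (at 0)" by (rule Lim_transform_eventually)
  then show ?thesis using True by (simp add: isCont_def area_ratio_def)
next
  case False
  then have "sin x \<noteq> 0" using assms by (metis sin_gt_zero sin_zero_pi_iff abs_less_iff minus_less_iff)
  then have "isCont (\<lambda>x. (x - sin x * cos x) / (sin x)\<^sup>2 :: real) x"
    by (intro continuous_intros) auto
  moreover have "eventually (\<lambda>x. x \<noteq> 0) (nhds x)" using False by (rule t1_space_nhds)
  then have "eventually (\<lambda>x. (x - sin x * cos x) / (sin x)\<^sup>2 = area_ratio x) (nhds x)"
    by eventually_elim (simp add: area_ratio_def)
  ultimately show ?thesis by (simp add: isCont_cong)
qed

text \<open>The endpoints of the interval correspond to the two arcs of the unit circle itself from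
  1 to \<open>cis (2 * \<theta>)\<close>, of curvature 1 and -1. They sweep areas of opposite sign,
  so the intermediate value theorem gives a solution strictly between them. Passing from \<theta> to
  \<open>\<theta> - pi\<close> changes neither \<open>sin \<theta> * cos \<theta>\<close> nor the
  squared sine.\<close>

lemma area_ratio_solution:
  assumes "0 < \<theta>" "\<theta> < pi"
  shows "\<exists>x. \<theta> - pi < x \<and> x < \<theta> \<and> area_ratio x = - cot \<theta>"
proof -
  have s: "sin \<theta> > 0" using assms by (intro sin_gt_zero)
  have e: "(y - sin \<theta> * cos \<theta>) / (sin \<theta>)\<^sup>2 = y / (sin \<theta>)\<^sup>2 - cot \<theta>" for y
    using s by (simp add: cot_def diff_divide_distrib power2_eq_square)
  have r: "area_ratio \<theta> > - cot \<theta>" using assms s e[of \<theta>] by (simp add: area_ratio_def)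
  have "area_ratio (\<theta> - pi) = (\<theta> - pi) / (sin \<theta>)\<^sup>2 - cot \<theta>"
    using assms e[of "\<theta> - pi"] by (simp add: area_ratio_def)
  moreover have "(\<theta> - pi) / (sin \<theta>)\<^sup>2 < 0" using assms s by (simp add: divide_neg_pos)
  ultimately have l: "area_ratio (\<theta> - pi) < - cot \<theta>" by linarith
  obtain x where "\<theta> - pi \<le> x" "x \<le> \<theta>" "area_ratio x = - cot \<theta>"
    using IVT'[of area_ratio "\<theta> - pi" "- cot \<theta>" \<theta>] l r assms
      continuous_at_imp_continuous_on[of "{\<theta> - pi..\<theta>}" area_ratio] isCont_area_ratio
    by (smt (verit) atLeastAtMost_iff)
  then show ?thesis using l r by (metis order_less_le order_less_irrefl)
qed

lemma cis_double_minus_1: "cis (2 * \<theta>) - 1 = 2 * \<i> * sin \<theta> * cis \<theta>"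
  by (auto simp: complex_eq_iff cos_double_sin sin_double power2_eq_square)

lemma unit_eq_of_scaleR_eq:
  fixes v w :: complex
  assumes "of_real r * v = of_real s * w" "norm v = 1" "norm w = 1" "r > 0" "s > 0"
  shows "r = s \<and> v = w"
proof -
  have "\<bar>r\<bar> * norm v = \<bar>s\<bar> * norm w"
    using arg_cong[OF assms(1), of norm] by (simp only: norm_mult norm_of_real)
  then have "r = s" using assms(2-5) by simp
  then show ?thesis using assms by simp
qed

text \<open>Areas scale with the square of the chord: a chord of length
  \<open>2 * sin \<theta>\<close> gives
  \<open>arc_lift a L = 2 * (sin \<theta>)\<^sup>2 * area_ratio x\<close>. The triangle term is the
  same multiple of \<open>cot \<theta>\<close>.\<close>

lemma zero_area_iff:
  assumes a: "a = sin x / sin \<theta>" and L: "a * L = 2 * x" and \<theta>: "sin \<theta> > 0" and x: "- pi < x" "x < pi"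
  shows "sin (2 * \<theta>) + arc_lift a L = 0 \<longleftrightarrow> area_ratio x = - cot \<theta>"
proof (cases "x = 0")
  case True
  then show ?thesis
    using assms by (auto simp: arc_lift_def area_ratio_def cot_def sin_double)
next
  case False
  then have "sin x \<noteq> 0" using x by (metis sin_gt_zero sin_zero_pi_iff abs_less_iff minus_less_iff)
  then have "arc_lift a L = (2 * x - sin (2 * x)) / (sin x / sin \<theta>)\<^sup>2"
    using \<theta> L unfolding arc_lift_def by (simp add: a)
  also have "\<dots> = 2 * (sin \<theta>)\<^sup>2 * area_ratio x"
    unfolding sin_double using False \<theta> by (simp add: area_ratio_def power_divide diff_divide_distrib
        left_diff_distrib right_diff_distrib mult_ac)
  finally have "arc_lift a L = 2 * (sin \<theta>)\<^sup>2 * area_ratio x" .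
  moreover have "sin (2 * \<theta>) = 2 * (sin \<theta>)\<^sup>2 * cot \<theta>"
    using \<theta> by (simp add: sin_double cot_def power2_eq_square)
  ultimately have "sin (2 * \<theta>) + arc_lift a L = 2 * (sin \<theta>)\<^sup>2 * (cot \<theta> + area_ratio x)"
    by (simp add: algebra_simps)
  then have "sin (2 * \<theta>) + arc_lift a L = 0 \<longleftrightarrow> cot \<theta> + area_ratio x = 0" using \<theta> by simp
  also have "\<dots> \<longleftrightarrow> area_ratio x = - cot \<theta>" by linarith
  finally show ?thesis .
qed

text \<open>The displacement \<open>cis (2 * \<theta>) - 1\<close> has length
  \<open>2 * sin \<theta>\<close> and direction \<open>\<i> * cis \<theta>\<close>. Comparing this
  polar form with that of the arc determines curvature and departure direction from the half angle
  \<open>x\<close>.\<close>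

lemma zero_area_chord_parameters:
  assumes c: "chord a u L" and e: "1 + u * unit_arc a L = cis (2 * \<theta>)" and \<theta>: "0 < \<theta>" "\<theta> < pi"
    and z: "Im (u * unit_arc a L) + arc_lift a L = 0"
  defines "x \<equiv> a * L / 2"
  shows "- pi < x" "x < pi" "area_ratio x = - cot \<theta>" "a = sin x / sin \<theta>" "u = \<i> * cis (\<theta> - x)"
proof -
  have u: "norm u = 1" and L: "L > 0" using c by (auto simp: chord_def)
  have "\<bar>a\<bar> * L < 2 * pi" using c chord_less_full_turn[of u L a] by (auto simp: chord_def)
  then have "\<bar>x\<bar> < pi" using L by (simp add: x_def abs_mult)
  then show x: "- pi < x" "x < pi" by auto
  have s: "sin \<theta> > 0" using \<theta> by (intro sin_gt_zero)
  have "u * unit_arc a L = cis (2 * \<theta>) - 1" using e by (metis add_diff_cancel_left')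
  then have eq: "of_real (arc_chord a L) * (u * cis x) = of_real (2 * sin \<theta>) * (\<i> * cis \<theta>)"
    unfolding cis_double_minus_1 unit_arc_eq_chord x_def by (simp add: mult_ac)
  have "arc_chord a L = 2 * sin \<theta> \<and> u * cis x = \<i> * cis \<theta>"
    by (rule unit_eq_of_scaleR_eq[OF eq]) (use u s chord_arc_chord_pos[OF c] in \<open>auto simp: norm_mult\<close>)
  then have 1: "arc_chord a L = 2 * sin \<theta>" and 2: "u * cis x = \<i> * cis \<theta>" by auto
  show a: "a = sin x / sin \<theta>"
    using 1 s by (auto simp: arc_chord_def x_def field_simps split: if_splits)
  have "u * cis x * cis (- x) = \<i> * cis (\<theta> - x)" unfolding 2 by (simp add: mult.assoc cis_mult)
  then show "u = \<i> * cis (\<theta> - x)" by (simp add: mult.assoc cis_mult)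
  have "Im (u * unit_arc a L) = sin (2 * \<theta>)" using e by (metis Im_complex_of_real add.left_neutral cis.sel(2) of_real_1 plus_complex.sel(2))
  then show "area_ratio x = - cot \<theta>"
    using zero_area_iff[OF a _ s x, of L] z by (simp add: x_def)
qed

text \<open>Strict monotonicity fixes the half angle, and with it the curvature and the direction.
  The half angle says nothing about the length when \<open>a = 0\<close>, so the length is taken
  from \<open>chord_length_unique\<close>.\<close>

lemma zero_area_chord_unique:
  assumes "chord a u L" "1 + u * unit_arc a L = cis (2 * \<theta>)" "Im (u * unit_arc a L) + arc_lift a L = 0"
    and "chord a' u' L'" "1 + u' * unit_arc a' L' = cis (2 * \<theta>)" "Im (u' * unit_arc a' L') + arc_lift a' L' = 0"
    and "0 < \<theta>" "\<theta> < pi"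
  shows "a = a' \<and> u = u' \<and> L = L'"
proof -
  note 1 = zero_area_chord_parameters[OF assms(1,2,7,8,3)]
  note 2 = zero_area_chord_parameters[OF assms(4,5,7,8,6)]
  have "a * L / 2 = a' * L' / 2"
    using area_ratio_less 1(1-3) 2(1-3) by (metis less_irrefl linorder_neqE)
  then have "a = a'" "u = u'" using 1(4,5) 2(4,5) by metis+
  then show ?thesis using chord_length_unique assms by blast
qed

lemma zero_area_chord_exists:
  assumes \<theta>: "0 < \<theta>" "\<theta> < pi"
  obtains a u L where "chord a u L" "1 + u * unit_arc a L = cis (2 * \<theta>)"
    "Im (u * unit_arc a L) + arc_lift a L = 0"
proof -
  obtain x where x: "\<theta> - pi < x" "x < \<theta>" "area_ratio x = - cot \<theta>"
    using area_ratio_solution[OF \<theta>] by blast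
  have x': "- pi < x" "x < pi" using x \<theta> by auto
  have s: "sin \<theta> > 0" using \<theta> by (intro sin_gt_zero)
  have sx: "sin (\<theta> - x) > 0" using x by (intro sin_gt_zero) auto
  define a where "a = sin x / sin \<theta>"
  define u where "u = \<i> * cis (\<theta> - x)"
  \<comment> \<open>The half angle fixes the length through \<open>a * L = 2 * x\<close> unless the
    arc is straight; then the length is that of the chord.\<close>
  define L where "L = (if x = 0 then 2 * sin \<theta> else 2 * x / a)"
  have sin_sgn: "x \<noteq> 0 \<Longrightarrow> x * sin x > 0"
    using x' sin_gt_zero[of x] sin_gt_zero[of "- x"] by (cases "x > 0") (auto simp: mult_neg_neg)
  have a0: "a = 0 \<longleftrightarrow> x = 0" using sin_sgn s by (cases "x = 0") (auto simp: a_def)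
  have aL: "a * L = 2 * x" using a0 by (simp add: L_def)
  have "x \<noteq> 0 \<Longrightarrow> x * a > 0" using sin_sgn s by (simp add: a_def)
  then have "x \<noteq> 0 \<Longrightarrow> x / a > 0" by (simp add: zero_less_divide_iff zero_less_mult_iff)
  then have L: "L > 0" using s by (auto simp: L_def)
  have \<sigma>L: "arc_chord a L = 2 * sin \<theta>"
  proof (cases "x = 0")
    case False
    then have "a * L / 2 = x" "sin x \<noteq> 0" using aL sin_sgn by auto
    then show ?thesis using False a0 s by (simp add: arc_chord_def) (simp add: a_def)
  qed (use a0 in \<open>simp add: arc_chord_def L_def\<close>)
  have u: "norm u = 1" by (simp add: u_def norm_mult)
  have "u * unit_arc a L = \<i> * (cis (\<theta> - x) * cis x) * of_real (2 * sin \<theta>)"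
    unfolding unit_arc_eq_chord \<sigma>L aL u_def by (simp add: mult_ac)
  also have "\<dots> = cis (2 * \<theta>) - 1" unfolding cis_double_minus_1 by (simp add: cis_mult mult_ac)
  finally have end_: "1 + u * unit_arc a L = cis (2 * \<theta>)" by simp
  have le: "norm (1 + u * unit_arc a t) \<le> 1" if t: "0 \<le> t" "t \<le> L" for t
  proof -
    define \<sigma> where "\<sigma> = arc_chord a t"
    define d where "d = u * cis (a * t / 2)"
    have d: "norm d = 1" using u by (simp add: d_def norm_mult)
    have "Re d = - sin (\<theta> - x + a * t / 2)" by (simp add: d_def u_def mult.assoc cis_mult)
    \<comment> \<open>With \<open>d\<close> a unit vector, the squared norm of the point is 1 +
      \<sigma> (\<sigma> + 2 Re d). The bound \<open>0 \<le> \<sigma> \<le> - 2 * Re d\<close>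
      therefore keeps the arc in the disc.\<close>
    moreover have "0 \<le> \<sigma> \<and> \<sigma> \<le> 2 * sin (\<theta> - x + a * t / 2)"
    proof (cases "x = 0")
      case True
      then show ?thesis using t a0 by (simp add: \<sigma>_def arc_chord_def L_def)
    next
      case False
      define y where "y = a * t / 2"
      define q where "q = t / L"
      have q: "0 \<le> q" "q \<le> 1" "y = q * x" using t L aL by (auto simp: q_def y_def field_simps)
      have y: "0 \<le> sin y / sin x" "0 \<le> sin (x - y) / sin x"
      proof -
        have *: "0 \<le> sin (p * x) / sin x" if "0 \<le> p" "p \<le> 1" for p
        proof (cases "x > 0")
          case True
          then have "0 \<le> p * x" "p * x \<le> x" using that by (auto intro: mult_left_le_one_le)
          then have "0 \<le> p * x" "p * x \<le> pi" using x' by linarith+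
          then show ?thesis using True x' sin_ge_zero[of "p * x"] sin_gt_zero[of x] by simp
        next
          case False
          then have "0 \<le> p * (- x)" "p * (- x) \<le> - x"
            using that mult_left_le_one_le[of "- x" p] by (auto simp: mult_nonneg_nonpos)
          then have "0 \<le> p * (- x)" "p * (- x) \<le> pi" using x' by linarith+
          then show ?thesis using False x' sin_ge_zero[of "p * (- x)"] sin_ge_zero[of "- x"]
            by (simp add: zero_le_divide_iff)
        qed
        show "0 \<le> sin y / sin x" using *[of q] q by simp
        have "x - y = (1 - q) * x" using q by (simp add: algebra_simps)
        then show "0 \<le> sin (x - y) / sin x" using *[of "1 - q"] q by simp
      qed
      have sx0: "sin x \<noteq> 0" using sin_sgn False by auto
      have \<sigma>: "\<sigma> = 2 * sin \<theta> * (sin y / sin x)"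
        using False a0 s sx0 by (simp add: \<sigma>_def arc_chord_def y_def[symmetric]) (simp add: a_def)
      \<comment> \<open>After division by \<open>sin x\<close>, the right side is a product of
        nonnegative factors: \<open>y\<close> lies between 0 and \<open>x\<close>, and
        \<open>\<theta> - x\<close> lies in the open interval from 0 to \<open>pi\<close>.\<close>
      have "sin x * sin (\<theta> - x + y) - sin y * sin \<theta> = sin (x - y) * sin (\<theta> - x)"
      proof -
        define b where "b = \<theta> - x"
        have "\<theta> = b + x" by (simp add: b_def)
        have "sin x * sin (b + y) - sin y * sin (b + x) = sin (x - y) * sin b"
          by (simp add: sin_add sin_diff algebra_simps)
        then show ?thesis by (simp add: b_def)
      qed
      then have "2 * sin (\<theta> - x + y) - \<sigma> = 2 * (sin (x - y) / sin x) * sin (\<theta> - x)"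
        unfolding \<sigma> using sx0 by (simp add: field_simps)
      moreover have "\<dots> \<ge> 0" by (intro mult_nonneg_nonneg) (use y sx in auto)
      ultimately have "\<sigma> \<le> 2 * sin (\<theta> - x + y)" by linarith
      moreover have "\<sigma> \<ge> 0" unfolding \<sigma> by (intro mult_nonneg_nonneg) (use y s in auto)
      ultimately show ?thesis by (simp add: y_def)
    qed
    ultimately have "0 \<le> \<sigma>" "\<sigma> + 2 * Re d \<le> 0" by auto
    then have "\<sigma> * (\<sigma> + 2 * Re d) \<le> 0" by (simp add: mult_nonneg_nonpos)
    moreover have "(norm (1 + d * of_real \<sigma>))\<^sup>2 = 1 + \<sigma> * (\<sigma> * (norm d)\<^sup>2 + 2 * Re d)"
      unfolding cmod_power2 by (simp add: power2_eq_square algebra_simps)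
    ultimately have "(norm (1 + d * of_real \<sigma>))\<^sup>2 \<le> 1" using d by simp
    then show ?thesis by (simp add: unit_arc_eq_chord \<sigma>_def d_def abs_square_le_1 mult.assoc)
  qed
  have "cnj (cis (2 * \<theta>)) * (u * cis (a * L)) = \<i> * cis (x - \<theta>)"
    by (simp add: aL u_def cis_cnj cis_mult mult.left_commute[of _ \<i>])
  then have "Re (cnj (1 + u * unit_arc a L) * (u * cis (a * L))) = sin (\<theta> - x)"
    unfolding end_ using sin_minus[of "\<theta> - x"] by simp
  moreover have "Re u < 0" using sx by (simp add: u_def)
  ultimately have "chord a u L"
    unfolding chord_def using u L sx le by (auto simp: end_)
  moreover have "Im (u * unit_arc a L) = sin (2 * \<theta>)"
    using end_ by (metis Im_complex_of_real add.left_neutral cis.sel(2) of_real_1 plus_complex.sel(2))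
  then have "Im (u * unit_arc a L) + arc_lift a L = 0"
    using zero_area_iff[OF a_def aL s x'] x by simp
  ultimately show ?thesis using end_ that by blast
qed

section \<open>Planar billiard trajectories\<close>

lemma constant_if_vector_derivative_zero:
  fixes f :: "real \<Rightarrow> 'a::banach"
  assumes "continuous_on {s..t} f" "\<And>x. x \<in> {s<..<t} \<Longrightarrow> (f has_vector_derivative 0) (at x)" "x \<in> {s..t}"
  shows "f x = f s"
proof (rule has_derivative_zero_unique_strong_interval[of "{s, t}" s t f])
  fix y assume "y \<in> {s..t} - {s, t}"
  then have "(f has_vector_derivative 0) (at y)" using assms(2) by auto
  then show "(f has_derivative (\<lambda>h. 0)) (at y within {s..t})"
    by (simp add: has_vector_derivative_def has_derivative_at_withinI)
qed (use assms in auto)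

text \<open>
  The plane projection \<open>c\<close> with velocity \<open>w\<close>, the height \<open>z\<close> and the curvature \<open>\<alpha>\<close> of a billiard
  trajectory; the reflection at \<open>c t\<close> maps \<open>w_in\<close> to \<open>- (c t)\<^sup>2 * cnj w_in\<close>.
\<close>

locale planar_billiard =
  fixes R :: "real set" and c w :: "real \<Rightarrow> complex" and z \<alpha> :: "real \<Rightarrow> real"
  assumes continuous_c: "continuous_on UNIV c" and continuous_z: "continuous_on UNIV z"
    and in_disc: "norm (c t) \<le> 1"
    and finite_R: "finite (R \<inter> {s..t})"
    and free: "t \<notin> R \<Longrightarrow> norm (w t) = 1 \<and> (c has_vector_derivative w t) (at t) \<and>
       (w has_vector_derivative \<i> * of_real (\<alpha> t) * w t) (at t) \<and> (\<alpha> has_real_derivative 0) (at t) \<and>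
       (z has_real_derivative Im (cnj (c t) * w t) / 2) (at t)"
    and reflect: "t \<in> R \<Longrightarrow> norm (c t) = 1 \<and> (\<exists>w_in a.
       (w \<longlongrightarrow> w_in) (at_left t) \<and> (w \<longlongrightarrow> - ((c t)\<^sup>2 * cnj w_in)) (at_right t) \<and>
       (\<alpha> \<longlongrightarrow> a) (at_left t) \<and> (\<alpha> \<longlongrightarrow> a) (at_right t) \<and>
       norm w_in = 1 \<and> Re (cnj (c t) * w_in) \<noteq> 0)"
begin

text \<open>The formulas for \<open>w\<close> and \<alpha> hold only on the open interval, because
  nothing is known about their values at reflection times. Those for \<open>c\<close> and
  \<open>z\<close> extend to the closed interval by continuity.\<close>

lemma free_arc:
  assumes "s < t" "{s<..<t} \<inter> R = {}"
  shows "\<exists>a W. norm W = 1 \<and> (\<forall>x\<in>{s<..<t}. w x = W * cis (a * (x - s)) \<and> \<alpha> x = a) \<and>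
    (\<forall>x\<in>{s..t}. c x = c s + W * unit_arc a (x - s) \<and>
       z x = z s + (Im (cnj (c s) * (W * unit_arc a (x - s))) + arc_lift a (x - s)) / 2)"
proof -
  have notR: "x \<notin> R" if "x \<in> {s<..<t}" for x using assms that by blast
  have "(\<alpha> has_vector_derivative 0) (at x within {s<..<t})" if "x \<in> {s<..<t}" for x
    using free[OF notR[OF that]] by (simp add: has_real_derivative_iff_has_vector_derivative has_vector_derivative_at_within)
  then obtain a where a: "\<And>x. x \<in> {s<..<t} \<Longrightarrow> \<alpha> x = a"
    using has_vector_derivative_zero_constant[of "{s<..<t}" \<alpha>] by auto
  \<comment> \<open>The factor undoes the rotation with angular speed \<open>a\<close>; it is the
    integrating factor of w' = i a w.\<close>
  have "((\<lambda>x. w x * cis (- a * (x - s))) has_vector_derivative 0) (at x within {s<..<t})" if x: "x \<in> {s<..<t}" for x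
  proof -
    have "(w has_vector_derivative \<i> * of_real a * w x) (at x within {s<..<t})"
      using free[OF notR[OF x]] a[OF x] by (auto intro: has_vector_derivative_at_within)
    from has_vector_derivative_mult[OF this has_vector_derivative_cis_mult[of "- a" s x]]
    show ?thesis by (simp add: algebra_simps)
  qed
  then obtain W where W: "\<And>x. x \<in> {s<..<t} \<Longrightarrow> w x * cis (- a * (x - s)) = W"
    using has_vector_derivative_zero_constant[of "{s<..<t}" "\<lambda>x. w x * cis (- a * (x - s))"] by auto
  have w: "w x = W * cis (a * (x - s))" if "x \<in> {s<..<t}" for x
    using W[OF that] by (auto simp: mult.assoc cis_mult)
  have nW: "norm W = 1"
  proof -
    have m: "(s + t) / 2 \<in> {s<..<t}" using assms by auto
    then show ?thesis using W[OF m] free[OF notR[OF m]] by (metis norm_cis norm_mult mult_1)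
  qed
  have cx: "c x = c s + W * unit_arc a (x - s)" if "x \<in> {s..t}" for x
  proof -
    have "c x - W * unit_arc a (x - s) = c s - W * unit_arc a (s - s)"
    proof (rule constant_if_vector_derivative_zero[OF _ _ that, of "\<lambda>x. c x - W * unit_arc a (x - s)"])
      show "continuous_on {s..t} (\<lambda>x. c x - W * unit_arc a (x - s))"
        by (intro continuous_intros continuous_on_subset[OF continuous_c]) auto
      fix x assume x: "x \<in> {s<..<t}"
      show "((\<lambda>x. c x - W * unit_arc a (x - s)) has_vector_derivative 0) (at x)"
        using has_vector_derivative_diff[OF conjunct1[OF conjunct2[OF free[OF notR[OF x]]]]
            has_vector_derivative_mult_right[OF has_vector_derivative_arc[of a s x UNIV], of W]] w[OF x]
        by simp
    qed
    then show ?thesis by (simp add: algebra_simps)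
  qed
  have zx: "z x = z s + (Im (cnj (c s) * (W * unit_arc a (x - s))) + arc_lift a (x - s)) / 2"
    if "x \<in> {s..t}" for x
  proof -
    \<comment> \<open>The first term is twice the signed triangle with vertices 0,
      \<open>c s\<close> and \<open>c x\<close>, the second twice the area between arc and chord.
      The division by 2 comes from dz = (1/2) r^2 d\<theta>.\<close>
    define f where "f x = (Im (cnj (c s) * W * unit_arc a (x - s)) + arc_lift a (x - s)) / 2" for x
    have f: "(f has_real_derivative Im (cnj (c s) * W * cis (a * (x - s)) + cnj (unit_arc a (x - s)) * cis (a * (x - s))) / 2)
        (at x within A)" for x A
    proof -
      have "((\<lambda>x. Im (cnj (c s) * W * unit_arc a (x - s))) has_real_derivative Im (cnj (c s) * W * cis (a * (x - s)))) (at x within A)"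
        unfolding has_real_derivative_iff_has_vector_derivative
        by (intro bounded_linear.has_vector_derivative[OF bounded_linear_Im]
            has_vector_derivative_mult_right has_vector_derivative_arc)
      from DERIV_cdivide[where c = 2, OF DERIV_add[OF this has_real_derivative_arc_lift]]
      show ?thesis by (simp add: f_def[abs_def])
    qed
    have "z x - f x = z s - f s"
    proof (rule constant_if_vector_derivative_zero[OF _ _ that, of "\<lambda>x. z x - f x"])
      have "continuous_on {s..t} f" using f by (intro DERIV_continuous_on)
      then show "continuous_on {s..t} (\<lambda>x. z x - f x)"
        by (intro continuous_intros continuous_on_subset[OF continuous_z]) auto
      fix x assume x: "x \<in> {s<..<t}"
      have "cnj (c x) * w x = cnj (c s) * W * cis (a * (x - s)) + (cnj W * W) * (cnj (unit_arc a (x - s)) * cis (a * (x - s)))"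
        using x by (subst cx) (auto simp: w algebra_simps)
      then have "cnj (c x) * w x = cnj (c s) * W * cis (a * (x - s)) + cnj (unit_arc a (x - s)) * cis (a * (x - s))"
        using unit_mult_cnj[OF nW] by (simp add: mult.commute)
      then have "(z has_real_derivative Im (cnj (c s) * W * cis (a * (x - s)) + cnj (unit_arc a (x - s)) * cis (a * (x - s))) / 2) (at x)"
        using free[OF notR[OF x]] by metis
      from DERIV_diff[OF this f] show "((\<lambda>x. z x - f x) has_vector_derivative 0) (at x)"
        by (simp add: has_real_derivative_iff_has_vector_derivative)
    qed
    then show ?thesis by (simp add: f_def mult.assoc)
  qed
  show ?thesis using nW w a cx zx by blast
qed

lemma reflection_gaps:
  obtains d where "d > 0" "{r<..<r + d} \<inter> R = {}" "{r - d<..<r} \<inter> R = {}"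
proof -
  obtain d where d: "d > 0" "\<And>x. x \<in> R \<inter> {r - 1..r + 1} \<Longrightarrow> x \<noteq> r \<Longrightarrow> d \<le> dist r x"
    using finite_set_avoid[OF finite_R[of "r - 1" "r + 1"], of r] by blast
  have "{r<..<r + min d 1} \<inter> R = {}" "{r - min d 1<..<r} \<inter> R = {}"
    using d(2) by (fastforce simp: dist_real_def)+
  then show ?thesis using that[of "min d 1"] d(1) by auto
qed

text \<open>One-sided limits are used because \<open>w\<close> and \<alpha> carry no information at
  \<open>r\<close> itself. Dividing the outgoing velocity by \<open>c r\<close> normalises the
  starting point to 1, as in \<open>chord\<close>.\<close>

definition departs :: "real \<Rightarrow> real \<Rightarrow> complex \<Rightarrow> bool" where
  "departs r a u \<longleftrightarrow> (w \<longlongrightarrow> c r * u) (at_right r) \<and> (\<alpha> \<longlongrightarrow> a) (at_right r)"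

text \<open>The constants supplied by \<open>free_arc\<close> are the right limits of
  \<open>w\<close> and \<alpha> at \<open>r\<close>, and uniqueness of limits identifies them with
  \<open>c r * u\<close> and \<open>a\<close>.\<close>

lemma departing_arc:
  assumes r: "r \<in> R" "departs r a u" and t: "r < t" "{r<..<t} \<inter> R = {}"
  shows "norm u = 1"
   "\<And>x. x \<in> {r<..<t} \<Longrightarrow> w x = c r * u * cis (a * (x - r))" "\<And>x. x \<in> {r<..<t} \<Longrightarrow> \<alpha> x = a"
   "\<And>x. x \<in> {r..t} \<Longrightarrow> c x = c r * (1 + u * unit_arc a (x - r))"
   "\<And>x. x \<in> {r..t} \<Longrightarrow> z x = z r + (Im (u * unit_arc a (x - r)) + arc_lift a (x - r)) / 2"
proof -
  obtain b W where *: "norm W = 1 \<and> (\<forall>x\<in>{r<..<t}. w x = W * cis (b * (x - r)) \<and> \<alpha> x = b) \<and>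
    (\<forall>x\<in>{r..t}. c x = c r + W * unit_arc b (x - r) \<and>
       z x = z r + (Im (cnj (c r) * (W * unit_arc b (x - r))) + arc_lift b (x - r)) / 2)"
    using free_arc[OF t] by (elim exE)
  then have W: "norm W = 1"
   "\<And>x. x \<in> {r<..<t} \<Longrightarrow> w x = W * cis (b * (x - r))" "\<And>x. x \<in> {r<..<t} \<Longrightarrow> \<alpha> x = b"
   "\<And>x. x \<in> {r..t} \<Longrightarrow> c x = c r + W * unit_arc b (x - r)"
   "\<And>x. x \<in> {r..t} \<Longrightarrow> z x = z r + (Im (cnj (c r) * (W * unit_arc b (x - r))) + arc_lift b (x - r)) / 2"
    by blast+
  have near: "eventually (\<lambda>x. x \<in> {r<..<t}) (at_right r)"
    using t(1) by (rule eventually_at_right_real)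
  have "((\<lambda>x. W * cis (b * (x - r))) \<longlongrightarrow> W * cis (b * (r - r))) (at_right r)"
    by (intro tendsto_intros)
  then have "(w \<longlongrightarrow> W * cis (b * (r - r))) (at_right r)"
    by (rule Lim_transform_eventually) (use near in eventually_elim, simp add: W)
  moreover have "(\<alpha> \<longlongrightarrow> b) (at_right r)"
    by (rule tendsto_eventually) (use near in eventually_elim, simp add: W)
  ultimately have "W * cis (b * (r - r)) = c r * u" "b = a"
    using r(2) tendsto_unique[OF trivial_limit_at_right_real] unfolding departs_def by metis+
  then have eq: "W = c r * u" "b = a" by simp_all
  have n: "norm (c r) = 1" using reflect[OF r(1)] by simp
  show "norm u = 1" using W(1) eq n by (simp add: norm_mult)
  show "w x = c r * u * cis (a * (x - r))" if "x \<in> {r<..<t}" for x using W(2)[OF that] eq by simp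
  show "\<alpha> x = a" if "x \<in> {r<..<t}" for x using W(3)[OF that] eq by simp
  show "c x = c r * (1 + u * unit_arc a (x - r))" if "x \<in> {r..t}" for x
    using W(4)[OF that] eq by (simp add: algebra_simps)
  have "cnj (c r) * (c r * u * y) = u * y" for y
    using unit_mult_cnj[OF n] by (metis mult.assoc mult.commute mult_1)
  then show "z x = z r + (Im (u * unit_arc a (x - r)) + arc_lift a (x - r)) / 2" if "x \<in> {r..t}" for x
    using W(5)[OF that] by (simp only: eq)
qed

text \<open>The incoming velocity is transversal to the circle, hence so is its mirror image; a
  departure with positive radial speed would leave the disc at once.\<close>

lemma departs_exists:
  assumes "r \<in> R"
  obtains a u where "departs r a u" "norm u = 1" "Re u < 0"
proof -
  obtain w_in a where w: "(w \<longlongrightarrow> - ((c r)\<^sup>2 * cnj w_in)) (at_right r)" "(\<alpha> \<longlongrightarrow> a) (at_right r)"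
    "Re (cnj (c r) * w_in) \<noteq> 0" using reflect[OF assms] by blast
  define u where "u = - (c r * cnj w_in)"
  have u: "departs r a u" "Re u \<noteq> 0"
    using w by (auto simp: departs_def u_def power2_eq_square mult.assoc)
  obtain d where d: "d > 0" "{r<..<r + d} \<inter> R = {}" using reflection_gaps by metis
  note arc = departing_arc[OF assms u(1) _ d(2)]
  have "Re u < 0"
  proof (rule ccontr)
    assume "\<not> Re u < 0"
    then have "Re u > 0" using u by simp
    then have "2 * Re (cnj (1 + u * unit_arc a 0) * (u * cis (a * 0))) > 0" by simp
    from DERIV_pos_inc_right[OF has_real_derivative_norm_arc this] obtain e where e: "e > 0"
      "\<And>h. h > 0 \<Longrightarrow> h < e \<Longrightarrow> (norm (1 + u * unit_arc a 0))\<^sup>2 < (norm (1 + u * unit_arc a (0 + h)))\<^sup>2"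
      by auto
    define h where "h = min (e / 2) d"
    have h: "h > 0" "h < e" "h \<le> d" using d e by (auto simp: h_def)
    have "norm (c (r + h)) = norm (1 + u * unit_arc a h)"
      using arc(4)[of "r + h"] h d reflect[OF assms] by (simp add: norm_mult)
    then have "(norm (1 + u * unit_arc a h))\<^sup>2 \<le> 1"
      using in_disc[of "r + h"] by (simp add: abs_square_le_1)
    then show False using e(2)[OF h(1,2)] by simp
  qed
  then show ?thesis using that[OF u(1) arc(1)] d by simp
qed

lemma departs_unique:
  assumes "r \<in> R" "departs r a u" "departs r a' u'"
  shows "a = a' \<and> u = u'"
proof -
  have "c r \<noteq> 0" using reflect[OF assms(1)] by auto
  moreover have "c r * u = c r * u'" "a = a'"
    using assms tendsto_unique[OF trivial_limit_at_right_real] unfolding departs_def by metis+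
  ultimately show ?thesis by simp
qed

lemma departs_unit_inward:
  assumes "r \<in> R" "departs r a u"
  shows "norm u = 1 \<and> Re u < 0"
proof -
  obtain a' u' where "departs r a' u'" "norm u' = 1" "Re u' < 0" using departs_exists[OF assms(1)] .
  then show ?thesis using departs_unique[OF assms] by blast
qed

text \<open>A free arc cannot stay in the disc forever: a straight one outgrows the diameter, and a
  curved one would complete a full turn. Local finiteness then provides the earliest later
  reflection.\<close>

lemma next_reflection:
  assumes "r \<in> R"
  obtains t where "t \<in> R" "r < t" "{r<..<t} \<inter> R = {}"
proof -
  have "\<exists>t\<in>R. r < t"
  proof (rule ccontr)
    assume none: "\<not> (\<exists>t\<in>R. r < t)"
    obtain a u where u: "departs r a u" "norm u = 1" "Re u < 0" using departs_exists[OF assms] .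
    have le: "norm (1 + u * unit_arc a s) \<le> 1" if "0 \<le> s" for s
    proof -
      have "c (r + s) = c r * (1 + u * unit_arc a s)"
        using departing_arc(4)[OF assms u(1), of "r + s + 1" "r + s"] none that by force
      then show ?thesis using in_disc[of "r + s"] reflect[OF assms] by (simp add: norm_mult)
    qed
    show False
    proof (cases "a = 0")
      case True
      \<comment> \<open>Any length above the diameter 2 gives the contradiction.\<close>
      have "norm (u * 3) \<le> norm (1 + u * 3) + norm (1::complex)"
        by (metis add_diff_cancel_left' norm_triangle_ineq4 add.commute)
      then show False using le[of 3] True u(2) by (simp add: unit_arc_def norm_mult)
    next
      case False
      then show False using chord_less_full_turn[OF u(2,3), of "2 * pi / \<bar>a\<bar>" a] le by simp
    qed
  qed
  then obtain t0 where t0: "t0 \<in> R" "r < t0" by blast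
  define S where "S = R \<inter> {r<..t0}"
  have S: "finite S" "S \<noteq> {}"
    using t0 finite_subset[OF _ finite_R[of r t0], of S] unfolding S_def by fastforce+
  have m: "Min S \<in> S" using S by simp
  have "{r<..<Min S} \<inter> R = {}"
  proof (intro equals0I)
    fix x assume x: "x \<in> {r<..<Min S} \<inter> R"
    then have "x \<in> S" using m by (auto simp: S_def)
    then show False using x Min_le[OF S(1)] by fastforce
  qed
  then show ?thesis using that m by (auto simp: S_def)
qed

text \<open>The left limit of \<open>w\<close> at \<open>t\<close> is the end tangent of the arc,
  and by \<open>chord_reflect\<close> its mirror image is \<open>c t * u\<close>. So the normalised
  departure data \<open>a\<close> and \<open>u\<close> are invariants of the whole
  trajectory.\<close>

lemma reflection_step:
  assumes r: "r \<in> R" "departs r a u" and t: "t \<in> R" "r < t" "{r<..<t} \<inter> R = {}"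
  shows "chord a u (t - r) \<and> departs t a u"
proof -
  note arc = departing_arc[OF r t(2,3)]
  have n: "norm (c r) = 1" "norm (c t) = 1" using reflect r t by auto
  define e where "e = 1 + u * unit_arc a (t - r)"
  have ct: "c t = c r * e" using arc(4)[of t] t by (simp add: e_def)
  obtain w_in b where w: "(w \<longlongrightarrow> w_in) (at_left t)" "(w \<longlongrightarrow> - ((c t)\<^sup>2 * cnj w_in)) (at_right t)"
    "(\<alpha> \<longlongrightarrow> b) (at_left t)" "(\<alpha> \<longlongrightarrow> b) (at_right t)" "Re (cnj (c t) * w_in) \<noteq> 0"
    using reflect[OF t(1)] by blast
  have near: "eventually (\<lambda>x. x \<in> {r<..<t}) (at_left t)"
    using t(2) by (rule eventually_at_left_real)
  have "((\<lambda>x. c r * u * cis (a * (x - r))) \<longlongrightarrow> c r * u * cis (a * (t - r))) (at_left t)"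
    by (intro tendsto_intros)
  then have "(w \<longlongrightarrow> c r * u * cis (a * (t - r))) (at_left t)"
    by (rule Lim_transform_eventually) (use near in eventually_elim, simp add: arc(2))
  moreover have "(\<alpha> \<longlongrightarrow> a) (at_left t)"
    by (rule tendsto_eventually) (use near in eventually_elim, rule arc(3))
  ultimately have eq: "w_in = c r * u * cis (a * (t - r))" "b = a"
    using w tendsto_unique[OF trivial_limit_at_left_real] by metis+
  have cc: "cnj (c r) * c r = 1" using unit_mult_cnj[OF n(1)] by (simp add: mult.commute)
  have "cnj (c t) * w_in = (cnj (c r) * c r) * (cnj e * (u * cis (a * (t - r))))"
    unfolding ct eq by simp
  then have trans: "Re (cnj e * (u * cis (a * (t - r)))) \<noteq> 0" using w(5) cc by simp
  have chord: "chord a u (t - r)"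
    unfolding chord_def e_def[symmetric]
  proof (intro conjI ballI trans)
    show "norm u = 1" "Re u < 0" using departs_unit_inward[OF r] by auto
    show "norm e = 1" using ct n by (simp add: norm_mult)
    show "norm (1 + u * unit_arc a s) \<le> 1" if "s \<in> {0..t - r}" for s
      using arc(4)[of "r + s"] that in_disc[of "r + s"] n by (simp add: norm_mult)
  qed (use t in simp)
  have "- ((c t)\<^sup>2 * cnj w_in) = c r * (cnj (c r) * c r) * (- (e\<^sup>2 * cnj (u * cis (a * (t - r)))))"
    unfolding ct eq by (simp add: power2_eq_square)
  also have "\<dots> = c t * u"
    unfolding cc chord_reflect[OF chord e_def] ct by simp
  finally have "- ((c t)\<^sup>2 * cnj w_in) = c t * u" .
  then have "departs t a u" using w eq by (simp add: departs_def)
  with chord show ?thesis by blast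
qed

text \<open>A derivative would equal both one-sided velocities, so the reflection would fix the
  velocity and \<open>u\<close> would be purely imaginary, against \<open>Re u < 0\<close>. The
  lemma makes reflection times visible in the curve itself.\<close>

lemma reflection_not_differentiable:
  assumes "r \<in> R"
  shows "\<not> (c has_vector_derivative D) (at r)"
proof
  assume D: "(c has_vector_derivative D) (at r)"
  obtain d where d: "d > 0" "{r<..<r + d} \<inter> R = {}" "{r - d<..<r} \<inter> R = {}"
    using reflection_gaps by metis
  obtain a u where u: "departs r a u" "norm u = 1" "Re u < 0" using departs_exists[OF assms] .
  have rd: "r < r + d" using d by simp
  note arc = departing_arc[OF assms u(1) rd d(2)]
  have "((\<lambda>x. c r * (1 + u * unit_arc a (x - r))) has_vector_derivative c r * (0 + u * cis (a * (r - r)))) (at r within {r..r + d})"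
    by (intro derivative_intros has_vector_derivative_mult_right has_vector_derivative_arc)
  then have "(c has_vector_derivative c r * (0 + u * cis (a * (r - r)))) (at r within {r..r + d})"
    by (rule has_vector_derivative_transform[rotated 2]) (use d in simp, rule arc(4))
  then have "(c has_vector_derivative c r * u) (at r within {r..r + d})" by simp
  moreover have "(c has_vector_derivative D) (at r within {r..r + d})"
    using D by (rule has_vector_derivative_at_within)
  ultimately have 1: "D = c r * u"
    using vector_derivative_unique_within_closed_interval[of r "r + d" r c] d by auto
  obtain w_in b where w: "(w \<longlongrightarrow> w_in) (at_left r)" "(w \<longlongrightarrow> - ((c r)\<^sup>2 * cnj w_in)) (at_right r)"
    "Re (cnj (c r) * w_in) \<noteq> 0"
    using reflect[OF assms] by blast
  have "r - d < r" using d by simp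
  from free_arc[OF this d(3)]
  obtain a' W where W: "\<And>x. x \<in> {r - d<..<r} \<Longrightarrow> w x = W * cis (a' * (x - (r - d)))"
   "\<And>x. x \<in> {r - d..r} \<Longrightarrow> c x = c (r - d) + W * unit_arc a' (x - (r - d))"
    by blast
  have near: "eventually (\<lambda>x. x \<in> {r - d<..<r}) (at_left r)"
    using d by (intro eventually_at_left_real) simp
  have "((\<lambda>x. W * cis (a' * (x - (r - d)))) \<longlongrightarrow> W * cis (a' * (r - (r - d)))) (at_left r)"
    by (intro tendsto_intros)
  then have "(w \<longlongrightarrow> W * cis (a' * (r - (r - d)))) (at_left r)"
    by (rule Lim_transform_eventually) (use near in eventually_elim, simp add: W(1))
  then have win: "w_in = W * cis (a' * (r - (r - d)))"
    using w(1) tendsto_unique[OF trivial_limit_at_left_real] by metis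
  have "((\<lambda>x. c (r - d) + W * unit_arc a' (x - (r - d))) has_vector_derivative 0 + W * cis (a' * (r - (r - d)))) (at r within {r - d..r})"
    by (intro derivative_intros has_vector_derivative_mult_right has_vector_derivative_arc)
  then have "(c has_vector_derivative 0 + W * cis (a' * (r - (r - d)))) (at r within {r - d..r})"
    by (rule has_vector_derivative_transform[rotated 2]) (use d in simp, rule W(2))
  then have "(c has_vector_derivative w_in) (at r within {r - d..r})" unfolding win by simp
  moreover have "(c has_vector_derivative D) (at r within {r - d..r})"
    using D by (rule has_vector_derivative_at_within)
  ultimately have 2: "D = w_in"
    using vector_derivative_unique_within_closed_interval[of "r - d" r r c] d by auto
  have "c r * u = - ((c r)\<^sup>2 * cnj w_in)"
    using u(1) w(2) tendsto_unique[OF trivial_limit_at_right_real] unfolding departs_def by metis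
  moreover have "w_in = c r * u" using 1 2 by simp
  ultimately have "c r * u = - (c r * (c r * cnj (c r)) * cnj u)"
    by (simp only: power2_eq_square mult.assoc complex_cnj_mult)
  moreover have "c r * cnj (c r) = 1" "c r \<noteq> 0" using reflect[OF assms] unit_mult_cnj by auto
  ultimately have "c r * u = c r * (- cnj u)" by simp
  then have "u = - cnj u" using \<open>c r \<noteq> 0\<close> by (metis mult_cancel_left)
  then show False using u(3) by (simp add: complex_eq_iff)
qed

end

text \<open>The trajectory started at \<open>(1, 0)\<close> that repeats the arc \<open>chord a u L\<close>.\<close>

definition orbit_plane :: "real \<Rightarrow> complex \<Rightarrow> real \<Rightarrow> real \<Rightarrow> complex" where
  "orbit_plane a u L t = (1 + u * unit_arc a L) powi \<lfloor>t / L\<rfloor> * (1 + u * unit_arc a (t - of_int \<lfloor>t / L\<rfloor> * L))"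

definition orbit_height :: "real \<Rightarrow> complex \<Rightarrow> real \<Rightarrow> real \<Rightarrow> real" where
  "orbit_height a u L t =
     (Im (u * unit_arc a (t - of_int \<lfloor>t / L\<rfloor> * L)) + arc_lift a (t - of_int \<lfloor>t / L\<rfloor> * L)) / 2"

lemma floor_shift:
  fixes L :: real
  assumes "L > 0"
  shows "\<lfloor>(t + of_int k * L) / L\<rfloor> = \<lfloor>t / L\<rfloor> + k"
proof -
  have "(t + of_int k * L) / L = t / L + of_int k" using assms by (simp add: add_divide_distrib)
  then show ?thesis by simp
qed

lemma floor_remainder:
  fixes L :: real
  assumes "L > 0"
  shows "t - of_int \<lfloor>t / L\<rfloor> * L \<in> {0..<L}"
proof -
  have "of_int \<lfloor>t / L\<rfloor> \<le> t / L" "t / L < of_int \<lfloor>t / L\<rfloor> + 1" by linarith+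
  then have "of_int \<lfloor>t / L\<rfloor> * L \<le> t" "t < (of_int \<lfloor>t / L\<rfloor> + 1) * L"
    using assms by (simp_all only: pos_le_divide_eq pos_divide_less_eq)
  then show ?thesis by (simp add: algebra_simps)
qed

lemma chord_end_nonzero: "chord a u L \<Longrightarrow> 1 + u * unit_arc a L \<noteq> 0"
  by (auto simp: chord_def)

lemma orbit_plane_shift:
  assumes "chord a u L"
  shows "orbit_plane a u L (t + of_int k * L) = (1 + u * unit_arc a L) powi k * orbit_plane a u L t"
proof -
  have L: "L > 0" using assms by (simp add: chord_def)
  have "t + of_int k * L - of_int (\<lfloor>t / L\<rfloor> + k) * L = t - of_int \<lfloor>t / L\<rfloor> * L"
    by (simp add: algebra_simps)
  moreover have "(1 + u * unit_arc a L) powi (\<lfloor>t / L\<rfloor> + k) =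
      (1 + u * unit_arc a L) powi k * (1 + u * unit_arc a L) powi \<lfloor>t / L\<rfloor>"
    using power_int_add[OF disjI1[OF chord_end_nonzero[OF assms]], of k "\<lfloor>t / L\<rfloor>"]
    by (simp only: add.commute)
  ultimately show ?thesis
    unfolding orbit_plane_def floor_shift[OF L] by (simp only: mult.assoc)
qed

lemma orbit_height_shift:
  assumes "chord a u L"
  shows "orbit_height a u L (t + of_int k * L) = orbit_height a u L t"
proof -
  have L: "L > 0" using assms by (simp add: chord_def)
  have "t + of_int k * L - of_int (\<lfloor>t / L\<rfloor> + k) * L = t - of_int \<lfloor>t / L\<rfloor> * L"
    by (simp add: algebra_simps)
  then show ?thesis
    unfolding orbit_height_def floor_shift[OF L] by (simp only:)
qed

lemma orbit_0 [simp]: "orbit_plane a u L 0 = 1" "orbit_height a u L 0 = 0"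
  by (simp_all add: orbit_plane_def orbit_height_def)

context planar_billiard
begin

text \<open>The data \<open>a\<close> and \<open>u\<close> do not change at reflections, and
  \<open>chord_length_unique\<close> forces every arc to have length \<open>L\<close>. The
  reflections after \<open>r\<close> are thus equally spaced, with the same rotation and the same
  height gain each time.\<close>

lemma reflection_chain:
  assumes r: "r \<in> R" "departs r a u" and L: "chord a u L"
    and first: "r + L \<in> R" "{r<..<r + L} \<inter> R = {}"
  defines "\<rho> \<equiv> 1 + u * unit_arc a L"
  defines "r' \<equiv> \<lambda>k::nat. r + real k * L"
  shows "r' k \<in> R \<and> departs (r' k) a u \<and> {r' k<..<r' k + L} \<inter> R = {} \<and> c (r' k) = c r * \<rho> ^ k \<and>
    z (r' k) = z r + real k * ((Im (u * unit_arc a L) + arc_lift a L) / 2)"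
proof (induction k)
  case 0
  show ?case using r first by (simp add: r'_def)
next
  case (Suc k)
  have Lpos: "L > 0" using L by (simp add: chord_def)
  define q where "q = r' k"
  have q: "q \<in> R" "departs q a u" "{q<..<q + L} \<inter> R = {}" "c q = c r * \<rho> ^ k"
    "z q = z r + real k * ((Im (u * unit_arc a L) + arc_lift a L) / 2)"
    using Suc.IH by (auto simp: q_def)
  obtain t where t: "t \<in> R" "q < t" "{q<..<t} \<inter> R = {}" using next_reflection[OF q(1)] .
  have step: "chord a u (t - q)" "departs t a u" using reflection_step[OF q(1,2) t] by auto
  have tL: "t = q + L" using chord_length_unique[OF step(1) L] by simp
  \<comment> \<open>The induction claim also contains the reflection-free gap after the new point,
    so one further reflection has to be located.\<close>
  obtain t' where t': "t' \<in> R" "t < t'" "{t<..<t'} \<inter> R = {}" using next_reflection[OF t(1)] .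
  have "chord a u (t' - t)" using reflection_step[OF t(1) step(2) t'] by auto
  then have t'L: "t' = t + L" using chord_length_unique[OF _ L] by force
  note arc = departing_arc[OF q(1,2) t(2,3)]
  have "c t = c q * \<rho>" "z t = z q + (Im (u * unit_arc a L) + arc_lift a L) / 2"
    using arc(4,5)[of t] t(2) tL by (simp_all add: \<rho>_def)
  moreover have "r' (Suc k) = t" by (simp add: tL q_def r'_def algebra_simps)
  ultimately show ?case
    using t(1) step(2) t'(3) t'L q(4,5) by (simp add: algebra_simps add_divide_distrib)
qed

end

section \<open>Consequences of periodicity\<close>

locale periodic_planar_billiard = planar_billiard +
  fixes T :: real
  assumes T_pos: "T > 0" and periodic: "c (t + T) = c t" "z (t + T) = z t"
begin

lemma periodic_nat: "c (t + real n * T) = c t \<and> z (t + real n * T) = z t"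
proof (induction n)
  case (Suc n)
  have "t + real (Suc n) * T = (t + real n * T) + T" by (simp add: algebra_simps)
  then show ?case using Suc periodic by metis
qed simp

text \<open>Without reflections the curvature is one constant \<open>a\<close>. If
  \<open>a = 0\<close>, the line leaves the disc. Otherwise \<open>arc_lift\<close> grows linearly
  in time while the triangle term stays bounded by \<open>2 / \<bar>a\<bar>\<close>, so the height
  cannot return after a large multiple of the period.\<close>

lemma reflections_exist: "R \<noteq> {}"
proof
  assume R: "R = {}"
  \<comment> \<open>The time \<open>1/2\<close> lies inside every interval considered, so the same
    curvature serves for all \<open>t\<close>.\<close>
  have arc: "\<exists>W. norm W = 1 \<and> (\<forall>x\<in>{0..t}. c x = c 0 + W * unit_arc (\<alpha> (1/2)) x \<and>
      z x = z 0 + (Im (cnj (c 0) * (W * unit_arc (\<alpha> (1/2)) x)) + arc_lift (\<alpha> (1/2)) x) / 2)"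
    if t: "1 \<le> t" for t
  proof -
    have "0 < t" "{0<..<t} \<inter> R = {}" using t R by auto
    from free_arc[OF this] obtain a W where W: "norm W = 1" "\<forall>x\<in>{0<..<t}. \<alpha> x = a"
      "\<forall>x\<in>{0..t}. c x = c 0 + W * unit_arc a (x - 0) \<and>
       z x = z 0 + (Im (cnj (c 0) * (W * unit_arc a (x - 0))) + arc_lift a (x - 0)) / 2"
      by blast
    have "\<alpha> (1/2) = a" using W(2) t by auto
    then show ?thesis using W(1) W(3)[unfolded diff_0_right] by blast
  qed
  define a where "a = \<alpha> (1/2)"
  show False
  proof (cases "a = 0")
    case True
    have "(3::real) \<in> {0..3}" by simp
    then obtain W where W: "norm W = 1" "c 3 = c 0 + W * unit_arc a 3"
      using arc[of 3] unfolding a_def by fastforce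
    have "W * 3 = c 3 - c 0" using W True by (simp add: unit_arc_def)
    then have "norm (W * 3) \<le> norm (c 3) + norm (c 0)" by (metis norm_triangle_ineq4)
    then show False using W(1) in_disc[of 0] in_disc[of 3] by (simp add: norm_mult)
  next
    case False
    \<comment> \<open>The two summands make \<open>t = n * T\<close> satisfy both
      \<open>2 * \<bar>a\<bar> + 1 < \<bar>a\<bar> * t\<close>, which contradicts the bound on the
      lift, and \<open>1 < t\<close>, as \<open>arc\<close> requires.\<close>
    obtain n :: nat where n: "(2 * \<bar>a\<bar> + 1) / (\<bar>a\<bar> * T) + 1 / T < real n" using reals_Archimedean2 by blast
    define t where "t = real n * T"
    have p: "0 < \<bar>a\<bar> * T" using False T_pos by simp
    have "0 \<le> (2 * \<bar>a\<bar> + 1) / (\<bar>a\<bar> * T)" "0 < 1 / T" using p T_pos by auto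
    then have "1 / T < real n" "(2 * \<bar>a\<bar> + 1) / (\<bar>a\<bar> * T) < real n" using n by linarith+
    then have t: "1 < t" "2 * \<bar>a\<bar> + 1 < \<bar>a\<bar> * t"
      using T_pos p by (auto simp: t_def divide_less_eq mult_ac)
    have "t \<in> {0..t}" "1 \<le> t" using t(1) by auto
    then obtain W where W: "norm W = 1"
      and zt: "z t = z 0 + (Im (cnj (c 0) * (W * unit_arc a t)) + arc_lift a t) / 2"
      using arc[of t] unfolding a_def by blast
    have "z t = z 0" using periodic_nat[of 0 n] by (simp add: t_def)
    then have "q = 0" if "z t = z 0 + q / 2" for q using that by simp
    from this[OF zt] have zero: "Im (cnj (c 0) * (W * unit_arc a t)) + arc_lift a t = 0" .
    have "\<bar>arc_lift a t\<bar> \<le> norm (cnj (c 0) * (W * unit_arc a t))"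
      using zero abs_Im_le_cmod[of "cnj (c 0) * (W * unit_arc a t)"] by linarith
    also have "\<dots> = norm (c 0) * norm (unit_arc a t)" using W by (simp add: norm_mult)
    also have "\<dots> \<le> 1 * (2 / \<bar>a\<bar>)" using in_disc[of 0] norm_unit_arc_le[OF False] by (intro mult_mono) auto
    finally have "\<bar>arc_lift a t\<bar> * (\<bar>a\<bar> * \<bar>a\<bar>) \<le> 1 * (2 / \<bar>a\<bar>) * (\<bar>a\<bar> * \<bar>a\<bar>)"
      by (rule mult_right_mono) simp
    moreover have "\<bar>a * t - sin (a * t)\<bar> = \<bar>arc_lift a t\<bar> * (\<bar>a\<bar> * \<bar>a\<bar>)"
      using False by (simp add: arc_lift_def power2_eq_square)
    moreover have "1 * (2 / \<bar>a\<bar>) * (\<bar>a\<bar> * \<bar>a\<bar>) = 2 * \<bar>a\<bar>"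
      using False by (simp del: abs_mult_self_eq)
    ultimately have "\<bar>a * t - sin (a * t)\<bar> \<le> 2 * \<bar>a\<bar>" by simp
    moreover have "\<bar>a * t\<bar> \<le> \<bar>a * t - sin (a * t)\<bar> + \<bar>sin (a * t)\<bar>" by linarith
    moreover have "\<bar>sin (a * t)\<bar> \<le> 1" by simp
    moreover have "\<bar>a * t\<bar> = \<bar>a\<bar> * t" using t by (simp add: abs_mult)
    ultimately show False using t(2) by linarith
  qed
qed

text \<open>The set \<open>R\<close> consists exactly of the times at which \<open>c\<close> has no
  derivative, a property invariant under translation by a period.\<close>

lemma reflections_shift: "t + T \<in> R \<longleftrightarrow> t \<in> R"
proof -
  have shift: "((\<lambda>y. c (y + h)) has_vector_derivative D) (at x)"
    if "(c has_vector_derivative D) (at (x + h))" for h D x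
  proof -
    have "((\<lambda>y. y + h) has_vector_derivative 1) (at x)"
      by (auto intro!: derivative_eq_intros)
    from vector_diff_chain_at[OF this that] show ?thesis by (simp add: o_def)
  qed
  have "(\<lambda>y. c (y + T)) = c" "(\<lambda>y. c (y + - T)) = c"
    using periodic(1) periodic(1)[of "_ - T"] by auto
  then have "(c has_vector_derivative D) (at t) \<longleftrightarrow> (c has_vector_derivative D) (at (t + T))" for D
    using shift[of D t T] shift[of D "t + T" "- T"] by auto
  then show ?thesis using free reflection_not_differentiable by blast
qed

lemma reflections_shift_nat: "t + real n * T \<in> R \<longleftrightarrow> t \<in> R"
proof (induction n)
  case (Suc n)
  have "t + real (Suc n) * T = (t + real n * T) + T" by (simp add: algebra_simps)
  then show ?case using Suc reflections_shift by metis
qed simp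

text \<open>Since \<open>r + T\<close> is again a reflection time, \<open>T\<close> is a multiple
  \<open>n * L\<close>. Returning in the plane gives \<rho>^n = 1, and returning in height makes n
  times the gain per arc, hence the gain itself, vanish.\<close>

theorem orbit_structure:
  assumes r: "r \<in> R"
  shows "\<exists>a u L n. chord a u L \<and> Im (u * unit_arc a L) + arc_lift a L = 0 \<and>
    n > 0 \<and> (1 + u * unit_arc a L) ^ n = 1 \<and> R = range (\<lambda>k::int. r + of_int k * L) \<and>
    (\<forall>t. c (r + t) = c r * orbit_plane a u L t \<and> z (r + t) = z r + orbit_height a u L t)"
proof -
  obtain a u where u: "departs r a u" using departs_exists[OF r] by metis
  obtain t where t: "t \<in> R" "r < t" "{r<..<t} \<inter> R = {}" using next_reflection[OF r] .
  define L where "L = t - r"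
  have chord: "chord a u L" using reflection_step[OF r u t] by (simp add: L_def)
  then have L: "L > 0" by (simp add: chord_def)
  define \<rho> where "\<rho> = 1 + u * unit_arc a L"
  have "r + L \<in> R" "{r<..<r + L} \<inter> R = {}" using t by (simp_all add: L_def)
  note chain = reflection_chain[OF r u chord this, folded \<rho>_def]
  have cr: "c r \<noteq> 0" using reflect[OF r] by auto
  have R_ge: "\<exists>k::nat. t = r + real k * L" if "t \<in> R" "t \<ge> r" for t
  proof -
    define k where "k = nat \<lfloor>(t - r) / L\<rfloor>"
    have k: "real k = of_int \<lfloor>(t - r) / L\<rfloor>" using that L by (simp add: k_def)
    have "t - r - real k * L \<in> {0..<L}" using floor_remainder[OF L, of "t - r"] k by simp
    then have "r + real k * L \<le> t" "t < r + real k * L + L" by auto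
    moreover have "t \<notin> {r + real k * L<..<r + real k * L + L}" using chain[of k] that by blast
    ultimately have "t = r + real k * L" by auto
    then show ?thesis by blast
  qed
  have "r + T \<in> R" using r reflections_shift by simp
  then obtain n where n: "r + T = r + real n * L" using R_ge[of "r + T"] T_pos by auto
  then have Tn: "T = real n * L" by simp
  have npos: "n > 0" using Tn T_pos by (cases n) auto
  have "c r * \<rho> ^ n = c r" using chain[of n] periodic(1)[of r] Tn by simp
  then have \<rho>n: "\<rho> ^ n = 1" using cr by simp
  have A: "Im (u * unit_arc a L) + arc_lift a L = 0"
    using chain[of n] periodic(2)[of r] Tn npos by simp
  have pos: "c (r + t) = c r * orbit_plane a u L t \<and> z (r + t) = z r + orbit_height a u L t" if "t \<ge> 0" for t
  proof -
    define k where "k = nat \<lfloor>t / L\<rfloor>"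
    have k: "\<lfloor>t / L\<rfloor> = int k" using that L by (simp add: k_def)
    define q where "q = r + real k * L"
    have s: "t - real k * L \<in> {0..<L}" using floor_remainder[OF L, of t] k by simp
    have q: "q \<in> R" "departs q a u" "q < q + L" "{q<..<q + L} \<inter> R = {}" "c q = c r * \<rho> ^ k" "z q = z r"
      using chain[of k] A L by (auto simp: q_def)
    have "r + t \<in> {q..q + L}" "r + t - q = t - real k * L" using s by (auto simp: q_def)
    then have "c (r + t) = c q * (1 + u * unit_arc a (t - real k * L))"
      "z (r + t) = z q + (Im (u * unit_arc a (t - real k * L)) + arc_lift a (t - real k * L)) / 2"
      using departing_arc(4,5)[OF q(1-4), of "r + t"] by metis+
    then show ?thesis
      using q(5,6) by (simp add: orbit_plane_def orbit_height_def k \<rho>_def mult.assoc)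
  qed
  have all: "c (r + t) = c r * orbit_plane a u L t \<and> z (r + t) = z r + orbit_height a u L t" for t
  proof -
    \<comment> \<open>The chain describes the trajectory only after \<open>r\<close>; adding enough
      periods moves any time there, and neither side of the claim changes.\<close>
    obtain N :: nat where "- t / T < real N" using reals_Archimedean2 by blast
    then have "- t < real N * T" using T_pos by (simp only: pos_divide_less_eq)
    then have N: "t + real N * T \<ge> 0" by simp
    have e: "t + real N * T = t + of_int (int (N * n)) * L" by (simp add: Tn)
    have "\<rho> powi int (N * n) = 1" by (metis \<rho>n mult.commute power_int_of_nat power_mult power_one)
    then have "orbit_plane a u L (t + real N * T) = orbit_plane a u L t"
      unfolding e orbit_plane_shift[OF chord] by (simp add: \<rho>_def)
    moreover have "orbit_height a u L (t + real N * T) = orbit_height a u L t"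
      unfolding e orbit_height_shift[OF chord] ..
    ultimately show ?thesis using pos[OF N] periodic_nat[of "r + t" N] by (simp add: add.assoc)
  qed
  have "R = range (\<lambda>k::int. r + of_int k * L)"
  proof (intro equalityI subsetI)
    fix t assume t: "t \<in> R"
    obtain N :: nat where "(r - t) / T < real N" using reals_Archimedean2 by blast
    then have "r - t < real N * T" using T_pos by (simp only: pos_divide_less_eq)
    then have N: "t + real N * T \<ge> r" by simp
    then obtain k where "t + real N * T = r + real k * L"
      using R_ge[OF _ N] t reflections_shift_nat by blast
    then have "t = r + of_int (int k - int (N * n)) * L" by (simp add: Tn algebra_simps)
    then show "t \<in> range (\<lambda>k::int. r + of_int k * L)" by blast
  next
    fix t assume "t \<in> range (\<lambda>k::int. r + of_int k * L)"
    then obtain k where k: "t = r + of_int k * L" by blast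
    define N where "N = nat \<bar>k\<bar>"
    have "\<bar>k\<bar> * int n \<ge> \<bar>k\<bar> * 1" using npos by (intro mult_left_mono) auto
    then have "k + int (N * n) \<ge> 0" by (simp add: N_def)
    then obtain j where j: "k + int (N * n) = int j" using nonneg_int_cases by blast
    have "t + real N * T = r + of_int (k + int (N * n)) * L" by (simp add: k Tn algebra_simps)
    also have "\<dots> = r + real j * L" unfolding j by simp
    finally show "t \<in> R" using chain[of j] reflections_shift_nat by metis
  qed
  then show ?thesis using chord A npos \<rho>n all unfolding \<rho>_def by blast
qed

end

section \<open>Reduction of the billiard in the cylinder to the plane\<close>

lemma vector_3_eq_axis: "(vector [x, y, h] :: real^3) = x *\<^sub>R axis 1 1 + y *\<^sub>R axis 2 1 + h *\<^sub>R axis 3 1"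
  by (simp add: vec_eq_iff forall_3 axis_def)

lemma vector_3_eta: "vector [v$1, v$2, v$3] = (v :: real^3)"
  by (simp add: vec_eq_iff forall_3)

lemma has_vector_derivative_vector_3:
  assumes "(f has_real_derivative f') (at t)" "(g has_real_derivative g') (at t)" "(h has_real_derivative h') (at t)"
  shows "((\<lambda>t. vector [f t, g t, h t] :: real^3) has_vector_derivative vector [f', g', h']) (at t)"
proof -
  have "((\<lambda>t. f t *\<^sub>R axis 1 1 + g t *\<^sub>R axis 2 1 + h t *\<^sub>R axis 3 1 :: real^3) has_vector_derivative
      ((f t *\<^sub>R 0 + f' *\<^sub>R axis 1 1) + (g t *\<^sub>R 0 + g' *\<^sub>R axis 2 1)) + (h t *\<^sub>R 0 + h' *\<^sub>R axis 3 1)) (at t)"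
    by (intro has_vector_derivative_add has_vector_derivative_scaleR assms has_vector_derivative_const)
  then show ?thesis by (simp add: vector_3_eq_axis)
qed

lemma has_vector_derivative_nth:
  "(f has_vector_derivative f') F \<Longrightarrow> ((\<lambda>t. f t $ i) has_real_derivative f' $ i) F"
  unfolding has_real_derivative_iff_has_vector_derivative
  by (rule bounded_linear.has_vector_derivative[OF bounded_linear_vec_nth])

lemma tendsto_vector_3 [tendsto_intros]:
  assumes "(f \<longlongrightarrow> f') F" "(g \<longlongrightarrow> g') F" "(h \<longlongrightarrow> h') F"
  shows "((\<lambda>t. vector [f t, g t, h t] :: real^3) \<longlongrightarrow> vector [f', g', h']) F"
  unfolding vector_3_eq_axis by (intro tendsto_intros assms)

lemma tendsto_Complex_iff:
  "((\<lambda>x. Complex (f x) (g x)) \<longlongrightarrow> Complex a b) F \<longleftrightarrow> (f \<longlongrightarrow> a) F \<and> (g \<longlongrightarrow> b) F"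
  by (simp add: tendsto_complex_iff)

lemma has_vector_derivative_Complex:
  assumes "(f has_real_derivative a) F" "(g has_real_derivative b) F"
  shows "((\<lambda>t. Complex (f t) (g t)) has_vector_derivative Complex a b) F"
proof -
  have "((\<lambda>t. of_real (f t) + \<i> * of_real (g t)) has_vector_derivative of_real a + \<i> * of_real b) F"
    using assms unfolding has_real_derivative_iff_has_vector_derivative
    by (intro has_vector_derivative_add has_vector_derivative_mult_right
        bounded_linear.has_vector_derivative[OF bounded_linear_of_real])
  then show ?thesis by (simp add: Complex_eq)
qed

lemma has_vector_derivative_Re: "(f has_vector_derivative a) F \<Longrightarrow> ((\<lambda>t. Re (f t)) has_real_derivative Re a) F"
  and has_vector_derivative_Im: "(f has_vector_derivative a) F \<Longrightarrow> ((\<lambda>t. Im (f t)) has_real_derivative Im a) F"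
  unfolding has_real_derivative_iff_has_vector_derivative
  by (rule bounded_linear.has_vector_derivative[OF bounded_linear_Re]
      bounded_linear.has_vector_derivative[OF bounded_linear_Im], assumption)+

text \<open>
  Along an orbit in the unit level of \<open>dual_norm\<close>, this is the velocity of the plane projection.
\<close>

definition velocity :: "real^3 \<Rightarrow> real^3 \<Rightarrow> complex" where
  "velocity q l = Complex (coeff_b q l) (coeff_c q l)"

lemma dual_norm_eq_norm_velocity: "dual_norm (q, l) = norm (velocity q l)"
  by (simp add: dual_norm_def velocity_def complex_norm)

text \<open>On the unit level the square root is differentiable and its derivative factor is 1/2,
  which cancels the 2 from the squares.\<close>

lemma has_derivative_dual_norm:
  assumes "dual_norm (q, l) = 1"
  shows "(dual_norm has_derivative (\<lambda>(u, v).
      coeff_b q l * (v$1 - (l$3 * u$2 + v$3 * q$2) / 2) + coeff_c q l * (v$2 + (l$3 * u$1 + v$3 * q$1) / 2))) (at (q, l))"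
proof -
  have fst: "((\<lambda>x. fst x $ i) has_derivative (\<lambda>h. fst h $ i)) (at (q, l))" for i :: 3
    by (rule bounded_linear_imp_has_derivative
        bounded_linear_compose[OF bounded_linear_vec_nth bounded_linear_fst])+
  have snd: "((\<lambda>x. snd x $ i) has_derivative (\<lambda>h. snd h $ i)) (at (q, l))" for i :: 3
    by (rule bounded_linear_imp_has_derivative
        bounded_linear_compose[OF bounded_linear_vec_nth bounded_linear_snd])+
  define B where "B x = snd x $ 1 - snd x $ 3 * fst x $ 2 / 2" for x :: "(real^3) \<times> (real^3)"
  define C where "C x = snd x $ 2 + snd x $ 3 * fst x $ 1 / 2" for x :: "(real^3) \<times> (real^3)"
  have B: "(B has_derivative (\<lambda>h. snd h $ 1 - (l$3 * fst h $ 2 + snd h $ 3 * q$2) / 2)) (at (q, l))"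
    unfolding B_def[abs_def] by (rule derivative_eq_intros fst snd refl | simp add: fun_eq_iff)+
  have C: "(C has_derivative (\<lambda>h. snd h $ 2 + (l$3 * fst h $ 1 + snd h $ 3 * q$1) / 2)) (at (q, l))"
    unfolding C_def[abs_def] by (rule derivative_eq_intros fst snd refl | simp add: fun_eq_iff)+
  have eq: "dual_norm = (\<lambda>x. sqrt (B x * B x + C x * C x))"
    by (auto simp: dual_norm_def B_def C_def coeff_b_def coeff_c_def power2_eq_square)
  have one: "B (q, l) * B (q, l) + C (q, l) * C (q, l) = 1" using assms by (simp add: eq)
  have "((\<lambda>x. sqrt (B x * B x + C x * C x)) has_derivative
    (\<lambda>h. (B (q, l) * (snd h $ 1 - (l$3 * fst h $ 2 + snd h $ 3 * q$2) / 2) +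
          (snd h $ 1 - (l$3 * fst h $ 2 + snd h $ 3 * q$2) / 2) * B (q, l) +
         (C (q, l) * (snd h $ 2 + (l$3 * fst h $ 1 + snd h $ 3 * q$1) / 2) +
          (snd h $ 2 + (l$3 * fst h $ 1 + snd h $ 3 * q$1) / 2) * C (q, l))) * (1 / (2 * 1)))) (at (q, l))"
    by (rule derivative_eq_intros B C refl | simp add: one fun_eq_iff)+
  then show ?thesis
    unfolding eq by (rule has_derivative_eq_rhs)
      (auto simp: fun_eq_iff B_def C_def coeff_b_def coeff_c_def)
qed

text \<open>Uniqueness of the differential lets the velocities be read off on the coordinate
  vectors. The third component of p' is 0 because the Hamiltonian does not depend on z; the third
  component of q' makes the curve tangent to the contact planes.\<close>

lemma hamilton_eq_dual_norm_iff:
  assumes "dual_norm (q t, p t) = 1"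
  shows "hamilton_eq_at dual_norm q p t \<longleftrightarrow>
    (q has_vector_derivative vector [coeff_b (q t) (p t), coeff_c (q t) (p t),
       (q t $ 1 * coeff_c (q t) (p t) - q t $ 2 * coeff_b (q t) (p t)) / 2]) (at t) \<and>
    (p has_vector_derivative vector [- (p t $ 3 * coeff_c (q t) (p t) / 2), p t $ 3 * coeff_b (q t) (p t) / 2, 0]) (at t)"
    (is "_ \<longleftrightarrow> (q has_vector_derivative ?q') _ \<and> (p has_vector_derivative ?p') _")
proof
  note D = has_derivative_dual_norm[OF assms]
  show "hamilton_eq_at dual_norm q p t"
    if "(q has_vector_derivative ?q') (at t) \<and> (p has_vector_derivative ?p') (at t)"
    unfolding hamilton_eq_at_def
  proof (intro exI conjI)
    show "(q has_vector_derivative ?q') (at t)" "(p has_vector_derivative ?p') (at t)" using that by auto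
    show "(dual_norm has_derivative (\<lambda>(u, v). ?q' \<bullet> v - ?p' \<bullet> u)) (at (q t, p t))"
      by (rule has_derivative_eq_rhs[OF D])
        (auto simp: fun_eq_iff inner_vec_def sum_3 algebra_simps add_divide_distrib diff_divide_distrib)
  qed
  assume "hamilton_eq_at dual_norm q p t"
  then obtain q' p' where qp: "(q has_vector_derivative q') (at t)" "(p has_vector_derivative p') (at t)"
    "(dual_norm has_derivative (\<lambda>(u, v). q' \<bullet> v - p' \<bullet> u)) (at (q t, p t))"
    by (auto simp: hamilton_eq_at_def)
  have eq: "q' \<bullet> v - p' \<bullet> u =
      coeff_b (q t) (p t) * (v$1 - (p t $3 * u$2 + v$3 * q t $2) / 2) +
      coeff_c (q t) (p t) * (v$2 + (p t $3 * u$1 + v$3 * q t $1) / 2)" for u v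
    using fun_cong[OF has_derivative_unique[OF qp(3) D], of "(u, v)"] by simp
  have "q' = ?q'"
    using eq[where u = 0 and v = "axis 1 1"] eq[where u = 0 and v = "axis 2 1"] eq[where u = 0 and v = "axis 3 1"]
    by (simp add: vec_eq_iff forall_3 inner_axis) (simp add: axis_def algebra_simps)
  moreover have "p' = ?p'"
    using eq[where v = 0 and u = "axis 1 1"] eq[where v = 0 and u = "axis 2 1"] eq[where v = 0 and u = "axis 3 1"]
    by (simp add: vec_eq_iff forall_3 inner_axis) (simp add: axis_def algebra_simps)
  ultimately show "(q has_vector_derivative ?q') (at t) \<and> (p has_vector_derivative ?p') (at t)"
    using qp by blast
qed

lemma norm_plane_proj_power2: "(norm (plane_proj q))\<^sup>2 = q$1 * q$1 + q$2 * q$2"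
  unfolding cmod_power2 by (simp add: plane_proj_def power2_eq_square)

lemma continuous_on_plane_proj: "continuous_on A plane_proj"
  unfolding plane_proj_def[abs_def] Complex_eq by (intro continuous_intros)

lemma interior_std_cylinder: "interior std_cylinder = {q. norm (plane_proj q) < 1}"
proof
  have "open {q. norm (plane_proj q) < 1}"
    by (intro open_Collect_less continuous_intros continuous_on_plane_proj)
  then show "{q. norm (plane_proj q) < 1} \<subseteq> interior std_cylinder"
    by (rule interior_maximal[rotated]) (auto simp: std_cylinder_def)
  show "interior std_cylinder \<subseteq> {q. norm (plane_proj q) < 1}"
  proof
    fix q assume q: "q \<in> interior std_cylinder"
    then obtain e where e: "e > 0" "ball q e \<subseteq> std_cylinder" by (auto simp: mem_interior)
    have le: "norm (plane_proj q) \<le> 1" using q interior_subset by (fastforce simp: std_cylinder_def)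
    have "norm (plane_proj q) \<noteq> 1"
    proof
      assume 1: "norm (plane_proj q) = 1"
      \<comment> \<open>Pushing a boundary point horizontally outward by \<open>e / 2\<close> stays
        in the ball but leaves the cylinder.\<close>
      define v :: "real^3" where "v = vector [q$1, q$2, 0]"
      have "norm v = 1"
        using norm_plane_proj_power2[of q] 1 by (simp add: v_def norm_eq_1 inner_vec_def sum_3)
      then have "q + (e / 2) *\<^sub>R v \<in> ball q e" using e by (simp add: dist_norm)
      then have "q + (e / 2) *\<^sub>R v \<in> std_cylinder" using e by blast
      moreover have "plane_proj (q + (e / 2) *\<^sub>R v) = of_real (1 + e / 2) * plane_proj q"
        by (simp add: plane_proj_def v_def complex_eq_iff algebra_simps)
      ultimately have "\<bar>1 + e / 2\<bar> \<le> 1" using 1 by (simp add: std_cylinder_def norm_mult del: of_real_add)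
      then show False using e by simp
    qed
    then show "q \<in> {q. norm (plane_proj q) < 1}" using le by simp
  qed
qed

lemma frontier_std_cylinder: "frontier std_cylinder = {q. norm (plane_proj q) = 1}"
proof -
  have "closed {q. norm (plane_proj q) \<le> 1}"
    by (intro closed_Collect_le continuous_intros continuous_on_plane_proj)
  then have "closed std_cylinder" by (simp add: std_cylinder_def)
  then show ?thesis
    by (auto simp: frontier_def interior_std_cylinder) (auto simp: std_cylinder_def)
qed

text \<open>Differentiating x^2 + y^2 = 1 along curves shows that radial covectors annihilate.
  Conversely, the vertical line and the horizontal rotation through \<open>q\<close> supply enough
  tangent vectors to leave only the radial direction.\<close>

lemma annihilator_tangent_std_cylinder:
  assumes q: "norm (plane_proj q) = 1"
  shows "l \<in> annihilator (tangent_space_at (frontier std_cylinder) q) \<longleftrightarrow> (\<exists>\<mu>. l = \<mu> *\<^sub>R vector [q$1, q$2, 0])"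
proof
  have q1: "q$1 * q$1 + q$2 * q$2 = 1" using norm_plane_proj_power2[of q] q by simp
  show "l \<in> annihilator (tangent_space_at (frontier std_cylinder) q)" if ex: "\<exists>\<mu>. l = \<mu> *\<^sub>R vector [q$1, q$2, 0]"
  proof -
    obtain \<mu> where l: "l = \<mu> *\<^sub>R vector [q$1, q$2, 0]" using ex by blast
    have "q$1 * v$1 + q$2 * v$2 = 0" if v: "v \<in> tangent_space_at (frontier std_cylinder) q" for v
    proof -
      obtain c where c: "c 0 = q" "\<forall>\<^sub>F t in nhds 0. c t \<in> frontier std_cylinder"
        "(c has_vector_derivative v) (at 0)"
        using v by (auto simp: tangent_space_at_def)
      have "((\<lambda>t. c t $ 1 * c t $ 1 + c t $ 2 * c t $ 2) has_real_derivative 2 * (q$1 * v$1 + q$2 * v$2)) (at 0)"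
        by (rule derivative_eq_intros has_vector_derivative_nth c refl | simp add: c)+
      moreover have "\<forall>\<^sub>F t in nhds 0. c t $ 1 * c t $ 1 + c t $ 2 * c t $ 2 = 1"
        using c(2) by eventually_elim (simp add: frontier_std_cylinder norm_plane_proj_power2[symmetric])
      then have "((\<lambda>t. c t $ 1 * c t $ 1 + c t $ 2 * c t $ 2) has_real_derivative 0) (at 0)"
        by (subst DERIV_cong_ev[OF refl _ refl, of _ "\<lambda>_. 1"]) auto
      ultimately show ?thesis using DERIV_unique by fastforce
    qed
    then show ?thesis
      by (auto simp: annihilator_def l inner_vec_def sum_3 distrib_left[symmetric] mult.assoc)
  qed
  assume "l \<in> annihilator (tangent_space_at (frontier std_cylinder) q)"
  then have ann: "l \<bullet> v = 0" if "v \<in> tangent_space_at (frontier std_cylinder) q" for v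
    using that by (auto simp: annihilator_def)
  have "vector [0, 0, 1] \<in> tangent_space_at (frontier std_cylinder) q"
    unfolding tangent_space_at_def
  proof (intro CollectI exI conjI)
    let ?c = "\<lambda>t. vector [q$1, q$2, q$3 + t] :: real^3"
    show "?c 0 = q" by (simp add: vector_3_eta)
    show "\<forall>\<^sub>F t in nhds 0. ?c t \<in> frontier std_cylinder"
      using q by (auto simp: frontier_std_cylinder plane_proj_def)
    show "(?c has_vector_derivative vector [0, 0, 1]) (at 0)"
      by (intro has_vector_derivative_vector_3) (auto intro!: derivative_eq_intros)
  qed
  from ann[OF this] have l3: "l$3 = 0" by (simp add: inner_vec_def sum_3)
  have "vector [- q$2, q$1, 0] \<in> tangent_space_at (frontier std_cylinder) q"
    unfolding tangent_space_at_def
  proof (intro CollectI exI conjI)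
    let ?c = "\<lambda>t. vector [q$1 * cos t - q$2 * sin t, q$2 * cos t + q$1 * sin t, q$3] :: real^3"
    show "?c 0 = q" by (simp add: vector_3_eta)
    have "plane_proj (?c t) = plane_proj q * cis t" for t
      by (simp add: plane_proj_def complex_eq_iff)
    then show "\<forall>\<^sub>F t in nhds 0. ?c t \<in> frontier std_cylinder"
      using q by (auto simp: frontier_std_cylinder norm_mult)
    show "(?c has_vector_derivative vector [- q$2, q$1, 0]) (at 0)"
      by (intro has_vector_derivative_vector_3) (auto intro!: derivative_eq_intros)
  qed
  from ann[OF this] have l12: "l$1 * q$2 = l$2 * q$1" by (simp add: inner_vec_def sum_3)
  define \<mu> where "\<mu> = q$1 * l$1 + q$2 * l$2"
  have "\<mu> * q$1 = l$1 * (q$1 * q$1 + q$2 * q$2)" "\<mu> * q$2 = l$2 * (q$1 * q$1 + q$2 * q$2)"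
    unfolding \<mu>_def using l12 by algebra+
  then have "l = \<mu> *\<^sub>R vector [q$1, q$2, 0]"
    using l3 q1 by (simp add: vec_eq_iff forall_3)
  then show "\<exists>\<mu>. l = \<mu> *\<^sub>R vector [q$1, q$2, 0]" by blast
qed

text \<open>Equality of the norms is a quadratic equation in the jump \<mu>, with roots 0 and
  \<open>2 * Re (cnj c * w)\<close>. The nonzero root is the mirror reflection, and its being
  nonzero is transversality.\<close>

lemma elastic_reflection:
  assumes "norm c = 1" "norm w = 1" "norm w' = 1" "w - w' = of_real \<mu> * c" "\<mu> \<noteq> 0"
  shows "w' = - (c\<^sup>2 * cnj w) \<and> Re (cnj c * w) \<noteq> 0"
proof -
  have cc: "cnj c * c = 1" using unit_mult_cnj[OF assms(1)] by (simp add: mult.commute)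
  have "w' = w - of_real \<mu> * c" using assms(4) by (simp add: algebra_simps)
  moreover have "(norm (w - of_real \<mu> * c))\<^sup>2 = (norm w)\<^sup>2 - 2 * \<mu> * Re (cnj c * w) + \<mu>\<^sup>2 * (norm c)\<^sup>2"
    unfolding cmod_power2 by (simp add: power2_eq_square algebra_simps)
  ultimately have "(norm w')\<^sup>2 = (norm w)\<^sup>2 - 2 * \<mu> * Re (cnj c * w) + \<mu>\<^sup>2 * (norm c)\<^sup>2"
    by simp
  then have "\<mu> * (\<mu> - 2 * Re (cnj c * w)) = 0" using assms(1-3) by (simp add: power2_eq_square algebra_simps)
  then have \<mu>: "\<mu> = 2 * Re (cnj c * w)" using assms(5) by simp
  have "of_real (2 * Re (cnj c * w)) = cnj c * w + c * cnj w"
    by (simp add: complex_eq_iff)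
  then have "w' = w - (cnj c * c) * w - c\<^sup>2 * cnj w"
    using \<open>w' = w - of_real \<mu> * c\<close> \<mu> by (simp add: power2_eq_square algebra_simps)
  then show ?thesis using cc \<mu> assms(5) by auto
qed

lemma reflected_minus:
  assumes "norm c = 1"
  shows "w - (- (c\<^sup>2 * cnj w)) = of_real (2 * Re (cnj c * w)) * c"
proof -
  have cc: "cnj c * c = 1" using unit_mult_cnj[OF assms(1)] by (simp add: mult.commute)
  have e: "of_real (2 * Re (cnj c * w)) = cnj c * w + c * cnj w"
    by (simp add: complex_eq_iff)
  have "of_real (2 * Re (cnj c * w)) * c = (cnj c * c) * w + c\<^sup>2 * cnj w"
    unfolding e by (simp add: power2_eq_square algebra_simps)
  then show ?thesis by (simp add: cc)
qed

text \<open>The covector with coefficients \<open>a\<close>, \<open>Re w\<close>,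
  \<open>Im w\<close> in the coframe \<alpha>, dx, dy at a point over \<open>c\<close>: the inverse
  of passing from a covector to its velocity and curvature.\<close>

definition momentum :: "complex \<Rightarrow> complex \<Rightarrow> real \<Rightarrow> real^3" where
  "momentum c w a = vector [Re w + a * Im c / 2, Im w - a * Re c / 2, a]"

lemma velocity_momentum [simp]: "velocity q (momentum (plane_proj q) w a) = w"
  by (simp add: velocity_def momentum_def coeff_b_def coeff_c_def plane_proj_def complex_eq_iff)

lemma momentum_nth_3 [simp]: "momentum c w a $ 3 = a"
  by (simp add: momentum_def)

lemma momentum_velocity: "momentum (plane_proj q) (velocity q l) (l$3) = l"
  by (simp add: velocity_def momentum_def coeff_b_def coeff_c_def plane_proj_def vec_eq_iff forall_3)

lemma momentum_diff: "momentum c w a - momentum c w' a = vector [Re (w - w'), Im (w - w'), 0]"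
  by (simp add: momentum_def vec_eq_iff forall_3)

lemma tendsto_momentum [tendsto_intros]:
  assumes "(c \<longlongrightarrow> c') F" "(w \<longlongrightarrow> w') F" "(a \<longlongrightarrow> a') F"
  shows "((\<lambda>t. momentum (c t) (w t) (a t)) \<longlongrightarrow> momentum c' w' a') F"
  unfolding momentum_def by (intro tendsto_intros assms) simp_all

lemma tendsto_velocity:
  assumes "(q \<longlongrightarrow> q') F" "(l \<longlongrightarrow> l') F"
  shows "((\<lambda>t. velocity (q t) (l t)) \<longlongrightarrow> velocity q' l') F"
  unfolding velocity_def tendsto_Complex_iff coeff_b_def coeff_c_def
  by (intro conjI tendsto_intros assms) simp_all

text \<open>In the variables \<open>c\<close>, \<open>w\<close>, curvature and height the system
  decouples. The velocity turns with angular speed \<open>p t $ 3\<close>: half of this comes from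
  the change of \<open>p\<close>, the other half from the moving base point in
  \<open>coeff_b\<close> and \<open>coeff_c\<close>.\<close>

lemma hamilton_eq_planar_iff:
  assumes "dual_norm (\<gamma> t, p t) = 1"
  defines "c \<equiv> plane_proj \<circ> \<gamma>" and "w \<equiv> \<lambda>t. velocity (\<gamma> t) (p t)"
  shows "hamilton_eq_at dual_norm \<gamma> p t \<longleftrightarrow>
     (c has_vector_derivative w t) (at t) \<and> (w has_vector_derivative \<i> * of_real (p t $ 3) * w t) (at t) \<and>
     ((\<lambda>t. p t $ 3) has_real_derivative 0) (at t) \<and>
     ((\<lambda>t. \<gamma> t $ 3) has_real_derivative Im (cnj (c t) * w t) / 2) (at t)"
  unfolding hamilton_eq_dual_norm_iff[of \<gamma> t p, OF assms(1)]
proof safe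
  assume q: "(\<gamma> has_vector_derivative vector [coeff_b (\<gamma> t) (p t), coeff_c (\<gamma> t) (p t),
       (\<gamma> t $ 1 * coeff_c (\<gamma> t) (p t) - \<gamma> t $ 2 * coeff_b (\<gamma> t) (p t)) / 2]) (at t)"
    and p: "(p has_vector_derivative vector [- (p t $ 3 * coeff_c (\<gamma> t) (p t) / 2), p t $ 3 * coeff_b (\<gamma> t) (p t) / 2, 0]) (at t)"
  note q' = has_vector_derivative_nth[OF q] and p' = has_vector_derivative_nth[OF p]
  show "(c has_vector_derivative w t) (at t)"
    using has_vector_derivative_Complex[OF q'[of 1] q'[of 2]]
    by (simp add: c_def w_def o_def plane_proj_def[abs_def] velocity_def)
  show "((\<lambda>t. p t $ 3) has_real_derivative 0) (at t)" using p'[of 3] by simp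
  show "((\<lambda>t. \<gamma> t $ 3) has_real_derivative Im (cnj (c t) * w t) / 2) (at t)"
    using q'[of 3] by (simp add: c_def w_def plane_proj_def velocity_def)
  have "((\<lambda>t. p t $ 1 - p t $ 3 * \<gamma> t $ 2 / 2) has_real_derivative - (p t $ 3 * coeff_c (\<gamma> t) (p t))) (at t)"
    by (rule derivative_eq_intros p'[of 1] p'[of 3] q'[of 2] refl | simp)+
  moreover have "((\<lambda>t. p t $ 2 + p t $ 3 * \<gamma> t $ 1 / 2) has_real_derivative p t $ 3 * coeff_b (\<gamma> t) (p t)) (at t)"
    by (rule derivative_eq_intros p'[of 2] p'[of 3] q'[of 1] refl | simp)+
  ultimately have "((\<lambda>t. Complex (coeff_b (\<gamma> t) (p t)) (coeff_c (\<gamma> t) (p t))) has_vector_derivative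
      Complex (- (p t $ 3 * coeff_c (\<gamma> t) (p t))) (p t $ 3 * coeff_b (\<gamma> t) (p t))) (at t)"
    unfolding coeff_b_def[of "\<gamma> _"] coeff_c_def[of "\<gamma> _"] by (rule has_vector_derivative_Complex)
  moreover have "Complex (- (p t $ 3 * coeff_c (\<gamma> t) (p t))) (p t $ 3 * coeff_b (\<gamma> t) (p t)) = \<i> * of_real (p t $ 3) * w t"
    by (simp add: w_def velocity_def complex_eq_iff)
  ultimately show "(w has_vector_derivative \<i> * of_real (p t $ 3) * w t) (at t)"
    by (simp add: w_def velocity_def)
next
  assume c: "(c has_vector_derivative w t) (at t)" and w: "(w has_vector_derivative \<i> * of_real (p t $ 3) * w t) (at t)"
    and a: "((\<lambda>t. p t $ 3) has_real_derivative 0) (at t)"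
    and z: "((\<lambda>t. \<gamma> t $ 3) has_real_derivative Im (cnj (c t) * w t) / 2) (at t)"
  have \<gamma>: "\<gamma> = (\<lambda>t. vector [Re (c t), Im (c t), \<gamma> t $ 3])"
    by (simp add: fun_eq_iff c_def plane_proj_def vector_3_eta)
  have "(\<gamma> has_vector_derivative vector [Re (w t), Im (w t), Im (cnj (c t) * w t) / 2]) (at t)"
    by (subst \<gamma>) (intro has_vector_derivative_vector_3 has_vector_derivative_Re has_vector_derivative_Im c z)
  then show "(\<gamma> has_vector_derivative vector [coeff_b (\<gamma> t) (p t), coeff_c (\<gamma> t) (p t),
       (\<gamma> t $ 1 * coeff_c (\<gamma> t) (p t) - \<gamma> t $ 2 * coeff_b (\<gamma> t) (p t)) / 2]) (at t)"
    by (simp add: c_def w_def plane_proj_def velocity_def)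
  have p: "p = (\<lambda>t. vector [Re (w t) + p t $ 3 * Im (c t) / 2, Im (w t) - p t $ 3 * Re (c t) / 2, p t $ 3])"
    using momentum_velocity[of "\<gamma> _" "p _"] by (simp add: fun_eq_iff momentum_def c_def w_def)
  have "((\<lambda>t. Re (w t) + p t $ 3 * Im (c t) / 2) has_real_derivative - (p t $ 3 * Im (w t) / 2)) (at t)"
    by (rule derivative_eq_intros has_vector_derivative_Re[OF w] has_vector_derivative_Im[OF c] a refl | simp)+
  moreover have "((\<lambda>t. Im (w t) - p t $ 3 * Re (c t) / 2) has_real_derivative p t $ 3 * Re (w t) / 2) (at t)"
    by (rule derivative_eq_intros has_vector_derivative_Im[OF w] has_vector_derivative_Re[OF c] a refl | simp)+
  ultimately have "((\<lambda>t. vector [Re (w t) + p t $ 3 * Im (c t) / 2, Im (w t) - p t $ 3 * Re (c t) / 2, p t $ 3] :: real^3)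
      has_vector_derivative vector [- (p t $ 3 * Im (w t) / 2), p t $ 3 * Re (w t) / 2, 0]) (at t)"
    by (intro has_vector_derivative_vector_3 a)
  then have "(p has_vector_derivative vector [- (p t $ 3 * Im (w t) / 2), p t $ 3 * Re (w t) / 2, 0]) (at t)"
    using p by metis
  then show "(p has_vector_derivative vector [- (p t $ 3 * coeff_c (\<gamma> t) (p t) / 2), p t $ 3 * coeff_b (\<gamma> t) (p t) / 2, 0]) (at t)"
    by (simp add: w_def velocity_def)
qed

text \<open>A radial jump of the momentum has no third component, so the curvature survives and the
  velocity jumps along the normal. The condition \<open>l_in \<noteq> l_out\<close> becomes
  transversality.\<close>

lemma reflection_planar_iff:
  assumes q: "norm (plane_proj q) = 1"
  shows "(dual_norm (q, l_in) = 1 \<and> dual_norm (q, l_out) = 1 \<and> l_in \<noteq> l_out \<and>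
      l_in - l_out \<in> annihilator (tangent_space_at (frontier std_cylinder) q)) \<longleftrightarrow>
    (l_in $ 3 = l_out $ 3 \<and> norm (velocity q l_in) = 1 \<and> Re (cnj (plane_proj q) * velocity q l_in) \<noteq> 0 \<and>
      velocity q l_out = - ((plane_proj q)\<^sup>2 * cnj (velocity q l_in)))"
    (is "?A \<longleftrightarrow> ?B")
proof
  let ?w = "velocity q l_in" and ?w' = "velocity q l_out" and ?c = "plane_proj q"
  have diff: "l_in - l_out = vector [Re (?w - ?w'), Im (?w - ?w'), 0]" if "l_in $ 3 = l_out $ 3"
    using momentum_diff[of ?c ?w "l_in $ 3" ?w'] momentum_velocity[of q l_in] momentum_velocity[of q l_out] that
    by simp
  show ?B if A: ?A
  proof -
    obtain \<mu> where \<mu>: "l_in - l_out = \<mu> *\<^sub>R vector [q$1, q$2, 0]"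
      using A annihilator_tangent_std_cylinder[OF q] by blast
    have 3: "l_in $ 3 = l_out $ 3" using arg_cong[OF \<mu>, of "\<lambda>v. v $ 3"] by simp
    have w: "?w - ?w' = of_real \<mu> * ?c"
      using \<mu> unfolding diff[OF 3] by (simp add: vec_eq_iff forall_3 complex_eq_iff plane_proj_def)
    have "\<mu> \<noteq> 0" using \<mu> A by auto
    from elastic_reflection[OF q _ _ w this] show ?B
      using A 3 unfolding dual_norm_eq_norm_velocity by blast
  qed
  assume B: ?B
  then have eq: "?w - ?w' = of_real (2 * Re (cnj ?c * ?w)) * ?c" using reflected_minus[OF q, of ?w] by simp
  have "l_in - l_out = (2 * Re (cnj ?c * ?w)) *\<^sub>R vector [q$1, q$2, 0]"
    unfolding diff[OF conjunct1[OF B]] eq by (simp add: vec_eq_iff forall_3 plane_proj_def)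
  moreover have "?c \<noteq> 0" using q by auto
  then have "?w - ?w' \<noteq> 0"
    unfolding eq mult_eq_0_iff of_real_eq_0_iff using B by simp
  then have "l_in \<noteq> l_out" by auto
  moreover have "norm ?w' = 1" using B q by (simp add: norm_mult norm_power)
  ultimately show ?A
    using B annihilator_tangent_std_cylinder[OF q] by (auto simp: dual_norm_eq_norm_velocity)
qed

text \<open>The witnesses are the velocity and the third component of the momentum. The velocity
  also depends on the base point, so its one-sided limits use continuity of the curve.\<close>

lemma billiard_trajectory_imp_planar:
  assumes "billiard_trajectory_with std_cylinder R \<gamma>"
  shows "\<exists>w \<alpha>. planar_billiard R (plane_proj \<circ> \<gamma>) w (\<lambda>t. \<gamma> t $ 3) \<alpha>"
proof -
  from assms obtain p where cont: "continuous_on UNIV \<gamma>" and ran: "range \<gamma> \<subseteq> std_cylinder"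
    and fin: "\<And>s t. finite (R \<inter> {s..t})"
    and free: "\<And>t. t \<notin> R \<Longrightarrow> dual_norm (\<gamma> t, p t) = 1 \<and> hamilton_eq_at dual_norm \<gamma> p t"
    and refl: "\<And>t. t \<in> R \<Longrightarrow> \<gamma> t \<in> frontier std_cylinder \<and> (\<exists>l_in l_out.
           (p \<longlongrightarrow> l_in) (at_left t) \<and> (p \<longlongrightarrow> l_out) (at_right t) \<and>
           dual_norm (\<gamma> t, l_in) = 1 \<and> dual_norm (\<gamma> t, l_out) = 1 \<and> l_in \<noteq> l_out \<and>
           l_in - l_out \<in> annihilator (tangent_space_at (frontier std_cylinder) (\<gamma> t)))"
    unfolding billiard_trajectory_with_def by blast
  have "planar_billiard R (plane_proj \<circ> \<gamma>) (\<lambda>t. velocity (\<gamma> t) (p t)) (\<lambda>t. \<gamma> t $ 3) (\<lambda>t. p t $ 3)"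
  proof
    show "continuous_on UNIV (plane_proj \<circ> \<gamma>)"
      by (rule continuous_on_compose[OF cont continuous_on_plane_proj])
    show "continuous_on UNIV (\<lambda>t. \<gamma> t $ 3)" by (intro continuous_intros cont)
    show "finite (R \<inter> {s..t})" for s t by (rule fin)
    show "norm ((plane_proj \<circ> \<gamma>) t) \<le> 1" for t using ran by (auto simp: std_cylinder_def)
    fix t
    show "norm (velocity (\<gamma> t) (p t)) = 1 \<and> (plane_proj \<circ> \<gamma> has_vector_derivative velocity (\<gamma> t) (p t)) (at t) \<and>
       ((\<lambda>t. velocity (\<gamma> t) (p t)) has_vector_derivative \<i> * of_real (p t $ 3) * velocity (\<gamma> t) (p t)) (at t) \<and>
       ((\<lambda>t. p t $ 3) has_real_derivative 0) (at t) \<and>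
       ((\<lambda>t. \<gamma> t $ 3) has_real_derivative Im (cnj ((plane_proj \<circ> \<gamma>) t) * velocity (\<gamma> t) (p t)) / 2) (at t)"
      if "t \<notin> R"
      using free[OF that] hamilton_eq_planar_iff[of \<gamma> t p] by (simp add: dual_norm_eq_norm_velocity)
    assume t: "t \<in> R"
    obtain l_in l_out where l: "(p \<longlongrightarrow> l_in) (at_left t)" "(p \<longlongrightarrow> l_out) (at_right t)"
      "dual_norm (\<gamma> t, l_in) = 1 \<and> dual_norm (\<gamma> t, l_out) = 1 \<and> l_in \<noteq> l_out \<and>
           l_in - l_out \<in> annihilator (tangent_space_at (frontier std_cylinder) (\<gamma> t))"
      using refl[OF t] by blast
    have n: "norm (plane_proj (\<gamma> t)) = 1" using refl[OF t] by (simp add: frontier_std_cylinder)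
    have \<gamma>: "(\<gamma> \<longlongrightarrow> \<gamma> t) (at t within A)" for A
      using cont by (metis UNIV_I continuous_on_def tendsto_within_subset subset_UNIV)
    note B = l(3)[unfolded reflection_planar_iff[OF n]]
    show "norm ((plane_proj \<circ> \<gamma>) t) = 1 \<and> (\<exists>w_in a.
       ((\<lambda>t. velocity (\<gamma> t) (p t)) \<longlongrightarrow> w_in) (at_left t) \<and>
       ((\<lambda>t. velocity (\<gamma> t) (p t)) \<longlongrightarrow> - (((plane_proj \<circ> \<gamma>) t)\<^sup>2 * cnj w_in)) (at_right t) \<and>
       ((\<lambda>t. p t $ 3) \<longlongrightarrow> a) (at_left t) \<and> ((\<lambda>t. p t $ 3) \<longlongrightarrow> a) (at_right t) \<and>
       norm w_in = 1 \<and> Re (cnj ((plane_proj \<circ> \<gamma>) t) * w_in) \<noteq> 0)"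
    proof (intro conjI exI)
      show "((\<lambda>t. velocity (\<gamma> t) (p t)) \<longlongrightarrow> velocity (\<gamma> t) l_in) (at_left t)"
        by (intro tendsto_velocity \<gamma> l)
      have "((\<lambda>t. velocity (\<gamma> t) (p t)) \<longlongrightarrow> velocity (\<gamma> t) l_out) (at_right t)"
        by (intro tendsto_velocity \<gamma> l)
      then show "((\<lambda>t. velocity (\<gamma> t) (p t)) \<longlongrightarrow> - (((plane_proj \<circ> \<gamma>) t)\<^sup>2 * cnj (velocity (\<gamma> t) l_in))) (at_right t)"
        using B by simp
      show "((\<lambda>t. p t $ 3) \<longlongrightarrow> l_in $ 3) (at_left t)" by (intro tendsto_intros l)
      have "((\<lambda>t. p t $ 3) \<longlongrightarrow> l_out $ 3) (at_right t)" by (intro tendsto_intros l)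
      then show "((\<lambda>t. p t $ 3) \<longlongrightarrow> l_in $ 3) (at_right t)" using B by simp
    qed (use n B in simp_all)
  qed
  then show ?thesis by blast
qed

lemma planar_imp_billiard_trajectory:
  assumes "planar_billiard R (plane_proj \<circ> \<gamma>) w (\<lambda>t. \<gamma> t $ 3) \<alpha>"
  shows "billiard_trajectory_with std_cylinder R \<gamma>"
proof -
  interpret planar_billiard R "plane_proj \<circ> \<gamma>" w "\<lambda>t. \<gamma> t $ 3" \<alpha> by (rule assms)
  define p where "p t = momentum (plane_proj (\<gamma> t)) (w t) (\<alpha> t)" for t
  have v: "velocity (\<gamma> t) (p t) = w t" "p t $ 3 = \<alpha> t" for t by (simp_all add: p_def)
  have \<gamma>: "\<gamma> = (\<lambda>t. vector [Re ((plane_proj \<circ> \<gamma>) t), Im ((plane_proj \<circ> \<gamma>) t), \<gamma> t $ 3])"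
    by (simp add: fun_eq_iff plane_proj_def vector_3_eta)
  have c_at: "((\<lambda>t. plane_proj (\<gamma> t)) \<longlongrightarrow> plane_proj (\<gamma> t)) (at t within A)" for t A
    using continuous_c unfolding o_def by (metis UNIV_I continuous_on_def tendsto_within_subset subset_UNIV)
  have cont: "continuous_on UNIV \<gamma>"
    by (subst \<gamma>, unfold vector_3_eq_axis) (intro continuous_intros continuous_c continuous_z)
  have reflection: "\<gamma> t \<in> frontier std_cylinder \<and> (\<exists>l_in l_out.
           (p \<longlongrightarrow> l_in) (at_left t) \<and> (p \<longlongrightarrow> l_out) (at_right t) \<and>
           dual_norm (\<gamma> t, l_in) = 1 \<and> dual_norm (\<gamma> t, l_out) = 1 \<and> l_in \<noteq> l_out \<and>
           l_in - l_out \<in> annihilator (tangent_space_at (frontier std_cylinder) (\<gamma> t)))"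
    if t: "t \<in> R" for t
  proof -
    have n: "norm (plane_proj (\<gamma> t)) = 1" using reflect[OF t] by simp
    obtain w_in a where w: "(w \<longlongrightarrow> w_in) (at_left t)" "(w \<longlongrightarrow> - ((plane_proj (\<gamma> t))\<^sup>2 * cnj w_in)) (at_right t)"
       "(\<alpha> \<longlongrightarrow> a) (at_left t)" "(\<alpha> \<longlongrightarrow> a) (at_right t)"
       "norm w_in = 1" "Re (cnj (plane_proj (\<gamma> t)) * w_in) \<noteq> 0"
      using reflect[OF t] by auto
    define l_in where "l_in = momentum (plane_proj (\<gamma> t)) w_in a"
    define l_out where "l_out = momentum (plane_proj (\<gamma> t)) (- ((plane_proj (\<gamma> t))\<^sup>2 * cnj w_in)) a"
    have "(p \<longlongrightarrow> l_in) (at_left t)" "(p \<longlongrightarrow> l_out) (at_right t)"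
      unfolding p_def[abs_def] l_in_def l_out_def by (intro tendsto_intros c_at w)+
    moreover have "l_in $ 3 = l_out $ 3 \<and> norm (velocity (\<gamma> t) l_in) = 1 \<and>
        Re (cnj (plane_proj (\<gamma> t)) * velocity (\<gamma> t) l_in) \<noteq> 0 \<and>
        velocity (\<gamma> t) l_out = - ((plane_proj (\<gamma> t))\<^sup>2 * cnj (velocity (\<gamma> t) l_in))"
      unfolding l_in_def l_out_def velocity_momentum momentum_nth_3 using w by blast
    ultimately show ?thesis
      using n unfolding reflection_planar_iff[OF n, symmetric] frontier_std_cylinder by blast
  qed
  have free': "dual_norm (\<gamma> t, p t) = 1 \<and> hamilton_eq_at dual_norm \<gamma> p t" if "t \<notin> R" for t
  proof
    show 1: "dual_norm (\<gamma> t, p t) = 1" using free[OF that] by (simp add: dual_norm_eq_norm_velocity v)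
    show "hamilton_eq_at dual_norm \<gamma> p t"
      unfolding hamilton_eq_planar_iff[of \<gamma> t p, OF 1] using free[OF that] by (simp add: v)
  qed
  have "range \<gamma> \<subseteq> std_cylinder" using in_disc by (auto simp: std_cylinder_def)
  then show ?thesis
    unfolding billiard_trajectory_with_def using cont finite_R free' reflection by blast
qed

section \<open>Existence, periodicity and uniqueness\<close>

lemma continuous_on_segments:
  fixes f :: "real \<Rightarrow> 'a::topological_space"
  assumes L: "L > 0" and seg: "\<And>k::int. continuous_on {of_int k * L..of_int k * L + L} f"
  shows "continuous_on UNIV f"
proof (rule continuous_at_imp_continuous_on, rule ballI)
  fix t :: real
  define s where "s = of_int \<lfloor>t / L\<rfloor> * L"
  have t: "s \<le> t" "t < s + L" using floor_remainder[OF L, of t] by (auto simp: s_def)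
  have "of_int (\<lfloor>t / L\<rfloor> - 1) * L = s - L" "of_int (\<lfloor>t / L\<rfloor> - 1) * L + L = s"
    by (simp_all add: s_def algebra_simps)
  then have "continuous_on {s - L..s} f" using seg[of "\<lfloor>t / L\<rfloor> - 1"] by metis
  moreover have "continuous_on {s..s + L} f" using seg[of "\<lfloor>t / L\<rfloor>"] by (simp add: s_def)
  ultimately have "continuous_on ({s - L..s} \<union> {s..s + L}) f"
    by (intro continuous_on_closed_Un) auto
  moreover have "{s - L..s} \<union> {s..s + L} = {s - L..s + L}" using L by auto
  ultimately show "isCont f t"
    using continuous_on_interior[of "{s - L..s + L}" f t] t L by simp
qed

lemma floor_div_eq:
  fixes L :: real
  assumes "L > 0" "of_int k * L \<le> t" "t < of_int k * L + L"
  shows "\<lfloor>t / L\<rfloor> = k"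
proof -
  have "of_int k \<le> t / L" using assms by (simp only: pos_le_divide_eq)
  moreover have "t < (of_int k + 1) * L" using assms by (simp add: algebra_simps)
  then have "t / L < of_int k + 1" using assms(1) by (simp only: pos_divide_less_eq)
  ultimately show ?thesis by linarith
qed

text \<open>At the right end of a segment the floor has already jumped, but the formula of the old
  segment still holds: the plane part by the rotation, the height because the arc sweeps area zero.
  This gives continuity of the glued orbit.\<close>

lemma orbit_on_segment:
  assumes "chord a u L" "Im (u * unit_arc a L) + arc_lift a L = 0"
    and t: "t \<in> {of_int k * L..of_int k * L + L}"
  shows "orbit_plane a u L t = (1 + u * unit_arc a L) powi k * (1 + u * unit_arc a (t - of_int k * L)) \<and>
    orbit_height a u L t = (Im (u * unit_arc a (t - of_int k * L)) + arc_lift a (t - of_int k * L)) / 2"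
proof (cases "t = of_int k * L + L")
  case False
  have "L > 0" using assms by (simp add: chord_def)
  then have "\<lfloor>t / L\<rfloor> = k" using False t by (intro floor_div_eq) auto
  then show ?thesis by (simp add: orbit_plane_def orbit_height_def)
next
  case True
  have 1: "t = 0 + of_int (k + 1) * L" "t - of_int k * L = L" using True by (auto simp: algebra_simps)
  have "orbit_plane a u L t = (1 + u * unit_arc a L) powi (k + 1) * 1" "orbit_height a u L t = 0"
    unfolding 1(1) orbit_plane_shift[OF assms(1)] orbit_height_shift[OF assms(1)] by simp_all
  then show ?thesis
    using assms(2) chord_end_nonzero[OF assms(1)] unfolding 1(2) by (simp add: power_int_add)
qed

lemma norm_power_int_unit: "norm (\<rho>::complex) = 1 \<Longrightarrow> norm (\<rho> powi k) = 1"
  by (simp add: norm_power_int)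

text \<open>Rotated copies of a chord fit together at the joints, and \<open>chord_reflect\<close>
  is the reflection law there. The factor \<open>e\<close> and the offset \<open>h\<close> prescribe
  the initial vertex and height.\<close>

theorem orbit_planar_billiard:
  assumes chord: "chord a u L" and area: "Im (u * unit_arc a L) + arc_lift a L = 0" and e: "norm e = 1"
  shows "planar_billiard (range (\<lambda>k::int. of_int k * L)) (\<lambda>t. e * orbit_plane a u L t)
    (\<lambda>t. e * (1 + u * unit_arc a L) powi \<lfloor>t / L\<rfloor> * (u * cis (a * (t - of_int \<lfloor>t / L\<rfloor> * L))))
    (\<lambda>t. h + orbit_height a u L t) (\<lambda>_. a)"
    (is "planar_billiard ?R ?c ?w ?z _")
proof
  define \<rho> where "\<rho> = 1 + u * unit_arc a L"
  have L: "L > 0" and u: "norm u = 1" and \<rho>: "norm \<rho> = 1" and le: "\<And>s. s \<in> {0..L} \<Longrightarrow> norm (1 + u * unit_arc a s) \<le> 1"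
    using chord by (auto simp: chord_def \<rho>_def)
  define g where "g k = e * \<rho> powi k" for k
  have g: "norm (g k) = 1" for k using e \<rho> by (simp add: g_def norm_mult norm_power_int_unit)
  have c: "?c t = g k * (1 + u * unit_arc a (t - of_int k * L))"
    and z: "?z t = h + (Im (u * unit_arc a (t - of_int k * L)) + arc_lift a (t - of_int k * L)) / 2"
    if "t \<in> {of_int k * L..of_int k * L + L}" for t k
    using orbit_on_segment[OF chord area that] by (simp_all add: g_def \<rho>_def mult.assoc)
  have w: "?w t = g k * (u * cis (a * (t - of_int k * L)))"
    if "t \<in> {of_int k * L..<of_int k * L + L}" for t k
    using floor_div_eq[OF L, of k t] that by (simp add: g_def \<rho>_def)
  have seg: "t \<in> {of_int \<lfloor>t / L\<rfloor> * L..<of_int \<lfloor>t / L\<rfloor> * L + L}" for t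
    using floor_remainder[OF L, of t] by auto
  have dF: "((\<lambda>t. K * (1 + u * unit_arc a (t - s))) has_vector_derivative K * (u * cis (a * (t - s)))) (at t within A)" for K s t A
  proof -
    have "((\<lambda>t. K * (1 + u * unit_arc a (t - s))) has_vector_derivative K * (0 + u * cis (a * (t - s)))) (at t within A)"
      by (intro derivative_intros has_vector_derivative_mult_right has_vector_derivative_arc)
    then show ?thesis by simp
  qed
  have dZ: "((\<lambda>t. h + (Im (u * unit_arc a (t - s)) + arc_lift a (t - s)) / 2) has_real_derivative
      (Im (u * cis (a * (t - s))) + Im (cnj (unit_arc a (t - s)) * cis (a * (t - s)))) / 2) (at t within A)" for s t A
  proof -
    have "((\<lambda>x. Im (u * unit_arc a (x - s))) has_real_derivative Im (u * cis (a * (t - s)))) (at t within A)"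
      unfolding has_real_derivative_iff_has_vector_derivative
      by (intro bounded_linear.has_vector_derivative[OF bounded_linear_Im]
          has_vector_derivative_mult_right has_vector_derivative_arc)
    from DERIV_add[OF DERIV_const DERIV_cdivide[where c = 2, OF DERIV_add[OF this has_real_derivative_arc_lift]], of h]
    show ?thesis by simp
  qed
  show "continuous_on UNIV ?c"
  proof (rule continuous_on_segments[OF L])
    fix k :: int
    have "continuous_on {of_int k * L..of_int k * L + L} (\<lambda>t. g k * (1 + u * unit_arc a (t - of_int k * L)))"
      by (intro continuous_intros)
    then show "continuous_on {of_int k * L..of_int k * L + L} ?c"
      by (rule continuous_on_eq) (simp only: c)
  qed
  show "continuous_on UNIV ?z"
  proof (rule continuous_on_segments[OF L])
    fix k :: int
    have "continuous_on {of_int k * L..of_int k * L + L}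
      (\<lambda>t. h + (Im (u * unit_arc a (t - of_int k * L)) + arc_lift a (t - of_int k * L)) / 2)"
      using dZ by (intro DERIV_continuous_on)
    then show "continuous_on {of_int k * L..of_int k * L + L} ?z"
      by (rule continuous_on_eq) (simp only: z)
  qed
  show "norm (?c t) \<le> 1" for t
  proof -
    have t: "t \<in> {of_int \<lfloor>t / L\<rfloor> * L..of_int \<lfloor>t / L\<rfloor> * L + L}" using seg[of t] by auto
    show ?thesis unfolding c[OF t] norm_mult g using le t by auto
  qed
  show "finite (?R \<inter> {s..t})" for s t
  proof (rule finite_subset)
    show "?R \<inter> {s..t} \<subseteq> (\<lambda>k::int. of_int k * L) ` {\<lfloor>s / L\<rfloor>..\<lceil>t / L\<rceil>}"
    proof
      fix x assume "x \<in> ?R \<inter> {s..t}"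
      then obtain k :: int where k: "x = of_int k * L" "s \<le> of_int k * L" "of_int k * L \<le> t" by auto
      then have "s / L \<le> of_int k" "of_int k \<le> t / L"
        using L by (simp_all only: pos_divide_le_eq pos_le_divide_eq)
      then have "k \<in> {\<lfloor>s / L\<rfloor>..\<lceil>t / L\<rceil>}" by (simp add: floor_le_iff le_ceiling_iff)
      then show "x \<in> (\<lambda>k::int. of_int k * L) ` {\<lfloor>s / L\<rfloor>..\<lceil>t / L\<rceil>}" using k by blast
    qed
  qed simp
  fix t
  show "norm (?w t) = 1 \<and> (?c has_vector_derivative ?w t) (at t) \<and>
       (?w has_vector_derivative \<i> * of_real a * ?w t) (at t) \<and> ((\<lambda>_. a) has_real_derivative 0) (at t) \<and>
       (?z has_real_derivative Im (cnj (?c t) * ?w t) / 2) (at t)" if tR: "t \<notin> ?R"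
  proof (intro conjI)
    define k where "k = \<lfloor>t / L\<rfloor>"
    define I where "I = {of_int k * L<..<of_int k * L + L}"
    have "t \<noteq> of_int k * L" using tR by blast
    then have I: "open I" "t \<in> I" using seg[of t] by (auto simp: I_def k_def less_le)
    have wt: "?w t = g k * (u * cis (a * (t - of_int k * L)))" using I by (intro w) (auto simp: I_def)
    have ct: "?c t = g k * (1 + u * unit_arc a (t - of_int k * L))" using I by (intro c) (auto simp: I_def)
    show "norm (?w t) = 1" unfolding wt by (simp add: norm_mult g u)
    show "(?c has_vector_derivative ?w t) (at t)"
      unfolding wt using dF I
      by (rule has_vector_derivative_transform_within_open) (intro c[symmetric], auto simp: I_def)
    have "((\<lambda>t. g k * (u * cis (a * (t - of_int k * L)))) has_vector_derivative
        g k * (u * (\<i> * of_real a * cis (a * (t - of_int k * L))))) (at t)"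
      by (intro has_vector_derivative_mult_right has_vector_derivative_cis_mult)
    then have "(?w has_vector_derivative g k * (u * (\<i> * of_real a * cis (a * (t - of_int k * L))))) (at t)"
      using I by (rule has_vector_derivative_transform_within_open) (intro w[symmetric], auto simp: I_def)
    then show "(?w has_vector_derivative \<i> * of_real a * ?w t) (at t)"
      unfolding wt by (simp add: mult_ac)
    have "cnj (?c t) * ?w t = (cnj (g k) * g k) * (u * cis (a * (t - of_int k * L)) +
        (cnj u * u) * (cnj (unit_arc a (t - of_int k * L)) * cis (a * (t - of_int k * L))))"
      unfolding wt ct by (simp add: algebra_simps)
    moreover have "cnj (g k) * g k = 1" "cnj u * u = 1"
      using unit_mult_cnj[OF g] unit_mult_cnj[OF u] by (simp_all add: mult.commute)
    ultimately have lift: "Im (cnj (?c t) * ?w t) / 2 = (Im (u * cis (a * (t - of_int k * L))) +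
        Im (cnj (unit_arc a (t - of_int k * L)) * cis (a * (t - of_int k * L)))) / 2"
      by (simp only: mult_1 plus_complex.sel)
    have "(?z has_real_derivative (Im (u * cis (a * (t - of_int k * L))) +
        Im (cnj (unit_arc a (t - of_int k * L)) * cis (a * (t - of_int k * L)))) / 2) (at t)"
      using dZ I by (rule has_field_derivative_transform_within_open) (intro z[symmetric], auto simp: I_def)
    from DERIV_cong[OF this lift[symmetric]]
    show "(?z has_real_derivative Im (cnj (?c t) * ?w t) / 2) (at t)" .
  qed simp
  assume "t \<in> ?R"
  then obtain k :: int where k: "t = of_int k * L" by blast
  have km: "of_int (k - 1) * L = t - L" by (simp add: k algebra_simps)
  \<comment> \<open>The left limit at \<open>t\<close> belongs to the segment with index
    \<open>k - 1\<close>, whose arc has just reached time \<open>L\<close>.\<close>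
  define w_in where "w_in = g (k - 1) * (u * cis (a * L))"
  have gk: "g k = g (k - 1) * \<rho>"
    using chord_end_nonzero[OF chord] by (simp add: g_def \<rho>_def power_int_diff)
  have ct: "?c t = g (k - 1) * \<rho>" using c[of t k] L k gk by simp
  have gg: "g (k - 1) * cnj (g (k - 1)) = 1" by (rule unit_mult_cnj[OF g])
  show "norm (?c t) = 1 \<and> (\<exists>w_in a'.
       (?w \<longlongrightarrow> w_in) (at_left t) \<and> (?w \<longlongrightarrow> - ((?c t)\<^sup>2 * cnj w_in)) (at_right t) \<and>
       ((\<lambda>_. a) \<longlongrightarrow> a') (at_left t) \<and> ((\<lambda>_. a) \<longlongrightarrow> a') (at_right t) \<and>
       norm w_in = 1 \<and> Re (cnj (?c t) * w_in) \<noteq> 0)"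
  proof (intro conjI exI)
    show "norm (?c t) = 1" unfolding ct by (simp add: norm_mult g \<rho>)
    show "norm w_in = 1" by (simp add: w_in_def norm_mult g u)
    have "((\<lambda>x. g (k - 1) * (u * cis (a * (x - (t - L))))) \<longlongrightarrow> g (k - 1) * (u * cis (a * (t - (t - L))))) (at_left t)"
      by (intro tendsto_intros)
    moreover have "eventually (\<lambda>x. x \<in> {t - L<..<t}) (at_left t)" using L by (intro eventually_at_left_real) simp
    then have "eventually (\<lambda>x. g (k - 1) * (u * cis (a * (x - (t - L)))) = ?w x) (at_left t)"
      by eventually_elim (subst w[of _ "k - 1"], auto simp only: km, auto)
    ultimately have "(?w \<longlongrightarrow> g (k - 1) * (u * cis (a * (t - (t - L))))) (at_left t)"
      by (rule Lim_transform_eventually)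
    then show "(?w \<longlongrightarrow> w_in) (at_left t)" by (simp add: w_in_def)
    have "((\<lambda>x. g k * (u * cis (a * (x - t)))) \<longlongrightarrow> g k * (u * cis (a * (t - t)))) (at_right t)"
      by (intro tendsto_intros)
    moreover have "eventually (\<lambda>x. x \<in> {t<..<t + L}) (at_right t)" using L by (intro eventually_at_right_real) simp
    then have "eventually (\<lambda>x. g k * (u * cis (a * (x - t))) = ?w x) (at_right t)"
      by eventually_elim (subst w[of _ k], auto simp: k)
    ultimately have "(?w \<longlongrightarrow> g k * (u * cis (a * (t - t)))) (at_right t)"
      by (rule Lim_transform_eventually)
    moreover have "- ((?c t)\<^sup>2 * cnj w_in) = g (k - 1) * (g (k - 1) * cnj (g (k - 1))) * (- (\<rho>\<^sup>2 * cnj (u * cis (a * L))))"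
      unfolding ct w_in_def by (simp add: power2_eq_square)
    then have "- ((?c t)\<^sup>2 * cnj w_in) = g k * u"
      unfolding gg chord_reflect[OF chord \<rho>_def] gk by simp
    ultimately show "(?w \<longlongrightarrow> - ((?c t)\<^sup>2 * cnj w_in)) (at_right t)" by simp
    have "cnj (?c t) * w_in = (g (k - 1) * cnj (g (k - 1))) * (cnj \<rho> * (u * cis (a * L)))"
      unfolding ct w_in_def by simp
    then show "Re (cnj (?c t) * w_in) \<noteq> 0"
      unfolding gg using chord by (simp add: chord_def \<rho>_def del: complex_cnj_add complex_cnj_mult complex_cnj_one)
  qed (rule tendsto_const)+
qed

section \<open>Roots of unity and vertices of regular polygons\<close>

lemma cis_2pi_eq_1_iff: "cis (2 * pi * x) = 1 \<longleftrightarrow> x \<in> \<int>"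
proof
  assume "cis (2 * pi * x) = 1"
  then have "cos (2 * pi * x) = 1" by (metis cis.sel(1) one_complex.sel(1))
  then obtain k :: int where "2 * pi * x = of_int k * 2 * pi" by (auto simp: cos_one_2pi_int)
  then show "x \<in> \<int>" by simp
next
  assume "x \<in> \<int>"
  then show "cis (2 * pi * x) = 1" by (rule cis_multiple_2pi)
qed

lemma cis_2pi_int_mult: "cis (2 * pi * of_int m / real n) powi k = cis (2 * pi * of_int (m * k) / real n)"
proof -
  have "cis x powi k = cis (of_int k * x)" for x
    by (cases k rule: int_cases2) (simp_all add: Complex.DeMoivre power_int_minus)
  then show ?thesis by (simp add: mult_ac)
qed

text \<open>The argument is a multiple of 2 pi / N; cancelling the greatest common divisor gives the
  reduced fraction, and \<open>\<rho> \<noteq> 1\<close> excludes denominator 1.\<close>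

lemma root_of_unity_primitive:
  fixes \<rho> :: complex
  assumes "\<rho> ^ N = 1" "N > 0" "\<rho> \<noteq> 1"
  obtains n m where "n \<ge> 2" "coprime m (int n)" "\<rho> = cis (2 * pi * of_int m / real n)"
proof -
  have "norm \<rho> = 1" using power_eq_1_iff[OF assms(1)] assms(2) by simp
  then have "cis (Arg \<rho>) = \<rho>" using rcis_cmod_Arg[of \<rho>] by (simp add: rcis_def)
  then have \<rho>: "\<rho> = cis (Arg \<rho>)" by (rule sym)
  have "cis (real N * Arg \<rho>) = \<rho> ^ N" by (simp only: Complex.DeMoivre[symmetric] \<rho>[symmetric])
  then have "cis (real N * Arg \<rho>) = 1" using assms(1) by simp
  then have "real N * Arg \<rho> / (2 * pi) \<in> \<int>" using cis_2pi_eq_1_iff[of "real N * Arg \<rho> / (2 * pi)"] by simp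
  then obtain k :: int where "real N * Arg \<rho> / (2 * pi) = of_int k" by (elim Ints_cases)
  then have "Arg \<rho> = 2 * pi * of_int k / real N" using assms(2) by (simp add: field_simps)
  from \<rho>[unfolded this] have \<rho>k: "\<rho> = cis (2 * pi * of_int k / real N)" .
  define g where "g = gcd k (int N)"
  have g: "g > 0" using assms(2) by (simp add: g_def)
  define m where "m = k div g"
  define n where "n = nat (int N div g)"
  have kN: "k = m * g" "int N = int N div g * g" by (simp_all add: m_def g_def)
  have "int N div g > 0" using kN(2) g assms(2) by (metis of_nat_0_less_iff zero_less_mult_pos2)
  then have n: "int n = int N div g" "n > 0" by (simp_all add: n_def)
  have cop: "coprime m (int n)"
    unfolding m_def n(1) g_def by (rule div_gcd_coprime) (use assms(2) in simp)
  have "real N = real n * of_int g" using kN(2) n(1) by (metis of_int_mult of_int_of_nat_eq)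
  then have "2 * pi * of_int k / real N = 2 * pi * of_int m / real n"
    using kN(1) g n(2) by simp
  from \<rho>k[unfolded this] have \<rho>m: "\<rho> = cis (2 * pi * of_int m / real n)" .
  have "n \<noteq> 1"
  proof
    assume "n = 1"
    moreover have "cis (2 * pi * of_int m) = 1" unfolding cis_2pi_eq_1_iff by simp
    ultimately have "\<rho> = 1" unfolding \<rho>m by simp
    then show False using assms(3) by simp
  qed
  then have "n \<ge> 2" using n(2) by simp
  then show thesis using that cop \<rho>m by blast
qed

lemma inscribed_regular_ngon_rotate:
  assumes P: "inscribed_regular_ngon n P" and v: "v \<in> P" and n: "n > 0"
  shows "v * cis (2 * pi * of_int j / real n) \<in> P"
proof -
  obtain w where w: "P = (\<lambda>k. w * cis (2 * pi * real k / real n)) ` {..<n}"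
    using P by (auto simp: inscribed_regular_ngon_def)
  then obtain k where k: "v = w * cis (2 * pi * real k / real n)" using v by blast
  define i where "i = (int k + j) mod int n"
  define q where "q = (int k + j) div int n"
  have i: "0 \<le> i" "i < int n" using n by (simp_all add: i_def)
  have "int k + j = q * int n + i" by (simp add: i_def q_def)
  then have "real k + of_int j = of_int q * real n + of_int i" by (metis of_int_add of_int_mult of_int_of_nat_eq)
  moreover have "2 * pi * real k / real n + 2 * pi * of_int j / real n = 2 * pi * (real k + of_int j) / real n"
    by (simp add: add_divide_distrib distrib_left)
  ultimately have "2 * pi * real k / real n + 2 * pi * of_int j / real n = 2 * pi * of_int q + 2 * pi * real (nat i) / real n"
    using n i(1) by (simp add: add_divide_distrib distrib_left)
  then have "v * cis (2 * pi * of_int j / real n) = w * (cis (2 * pi * of_int q) * cis (2 * pi * real (nat i) / real n))"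
    unfolding k by (simp add: mult.assoc cis_mult)
  then have "v * cis (2 * pi * of_int j / real n) = w * cis (2 * pi * real (nat i) / real n)"
    using cis_2pi_eq_1_iff[of "of_int q"] by simp
  then show ?thesis unfolding w by (rule image_eqI) (use i in auto)
qed

lemma inscribed_regular_ngon_difference:
  assumes P: "inscribed_regular_ngon n P" and v: "v \<in> P" "v' \<in> P" and n: "n > 0"
  obtains j :: int where "v' = v * cis (2 * pi * of_int j / real n)"
proof -
  obtain w where w: "P = (\<lambda>k. w * cis (2 * pi * real k / real n)) ` {..<n}"
    using P by (auto simp: inscribed_regular_ngon_def)
  then obtain k k' where k: "v = w * cis (2 * pi * real k / real n)" "v' = w * cis (2 * pi * real k' / real n)"
    using v by blast
  have "2 * pi * real k' / real n = 2 * pi * real k / real n + 2 * pi * of_int (int k' - int k) / real n"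
    by (simp add: add_divide_distrib[symmetric] algebra_simps)
  then have "v' = v * cis (2 * pi * of_int (int k' - int k) / real n)"
    unfolding k by (simp only: mult.assoc cis_mult)
  then show thesis by (rule that)
qed

lemma norm_inscribed_regular_ngon: "inscribed_regular_ngon n P \<Longrightarrow> v \<in> P \<Longrightarrow> norm v = 1"
  by (auto simp: inscribed_regular_ngon_def norm_mult)

section \<open>Polygonal trajectories in the cylinder\<close>

lemma periodic_billiard_imp_planar:
  assumes "billiard_trajectory_with std_cylinder R \<gamma>" "is_period \<gamma> T"
  obtains w \<alpha> where "periodic_planar_billiard R (plane_proj \<circ> \<gamma>) w (\<lambda>t. \<gamma> t $ 3) \<alpha> T"
proof -
  obtain w \<alpha> where "planar_billiard R (plane_proj \<circ> \<gamma>) w (\<lambda>t. \<gamma> t $ 3) \<alpha>"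
    using billiard_trajectory_imp_planar[OF assms(1)] by blast
  then have "periodic_planar_billiard R (plane_proj \<circ> \<gamma>) w (\<lambda>t. \<gamma> t $ 3) \<alpha> T"
    using assms(2) by (simp add: periodic_planar_billiard_def periodic_planar_billiard_axioms_def is_period_def)
  then show thesis by (rule that)
qed

lemma real3_eqI: "plane_proj q = plane_proj q' \<Longrightarrow> q $ 3 = q' $ 3 \<Longrightarrow> q = q'"
  by (simp add: plane_proj_def vec_eq_iff forall_3)

text \<open>After n arcs the rotations compose to the identity, so \<open>n * L\<close> is a period.
  Conversely, a period permutes the reflection times, so it is some \<open>j * L\<close>; returning
  to the same vertex means that n divides \<open>m * j\<close>, hence \<open>j\<close> by
  coprimality.\<close>

lemma orbit_ngon_trajectory:
  assumes bill: "billiard_trajectory_with std_cylinder (range (\<lambda>k::int. r + of_int k * L)) \<gamma>"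
    and chord: "chord a u L" and area: "Im (u * unit_arc a L) + arc_lift a L = 0"
    and plane: "\<And>t. plane_proj (\<gamma> (r + t)) = e * orbit_plane a u L t"
    and height: "\<And>t. \<gamma> (r + t) $ 3 = h + orbit_height a u L t"
    and \<rho>: "1 + u * unit_arc a L = cis (2 * pi * of_int m / real n)"
    and n: "n > 0" and cop: "coprime m (int n)" and P: "inscribed_regular_ngon n P" and e: "e \<in> P"
  shows "ngon_trajectory n P m \<gamma>"
proof -
  have L: "L > 0" and u: "norm u = 1" using chord by (auto simp: chord_def)
  have e0: "e \<noteq> 0" and ne: "norm e = 1" using norm_inscribed_regular_ngon[OF P e] by auto
  define \<tau> where "\<tau> k = r + of_int k * L" for k :: int
  have bill: "billiard_trajectory_with std_cylinder (range \<tau>) \<gamma>" using bill by (simp add: \<tau>_def[abs_def])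
  define \<rho>' where "\<rho>' = 1 + u * unit_arc a L"
  have powi: "\<rho>' powi k = cis (2 * pi * of_int (m * k) / real n)" for k
    unfolding \<rho>'_def \<rho> by (rule cis_2pi_int_mult)
  have vertex: "plane_proj (\<gamma> (\<tau> k)) = e * \<rho>' powi k" for k
    using plane[of "0 + of_int k * L"] orbit_plane_shift[OF chord, of 0 k] by (simp add: \<tau>_def \<rho>'_def)
  have seg: "plane_proj (\<gamma> x) = e * \<rho>' powi k * (1 + u * unit_arc a (x - \<tau> k))" if "x \<in> {\<tau> k..\<tau> (k + 1)}" for x k
  proof -
    have "x - r \<in> {of_int k * L..of_int k * L + L}" using that by (auto simp: \<tau>_def algebra_simps)
    from orbit_on_segment[OF chord area this] plane[of "x - r"] show ?thesis
      by (simp add: \<rho>'_def \<tau>_def diff_diff_eq mult.assoc)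
  qed
  have period: "is_period \<gamma> (real n * L)"
    unfolding is_period_def
  proof (intro conjI allI)
    show "real n * L > 0" using n L by simp
    fix t
    have 1: "t + real n * L = r + ((t - r) + of_int (int n) * L)" by simp
    have "cis (2 * pi * of_int m) = 1" unfolding cis_2pi_eq_1_iff by simp
    moreover have "2 * pi * of_int (m * int n) / real n = 2 * pi * of_int m" using n by simp
    ultimately have \<rho>n: "\<rho>' powi int n = 1" unfolding powi by (simp only:)
    show "\<gamma> (t + real n * L) = \<gamma> t"
    proof (rule real3_eqI)
      show "plane_proj (\<gamma> (t + real n * L)) = plane_proj (\<gamma> t)"
        unfolding 1 plane orbit_plane_shift[OF chord] \<rho>n[unfolded \<rho>'_def]
        using plane[of "t - r"] by simp
      show "\<gamma> (t + real n * L) $ 3 = \<gamma> t $ 3"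
        unfolding 1 height orbit_height_shift[OF chord] using height[of "t - r"] by simp
    qed
  qed
  have minimal: "real n * L \<le> T'" if T': "is_period \<gamma> T'" for T'
  proof -
    obtain w \<alpha> where "periodic_planar_billiard (range \<tau>) (plane_proj \<circ> \<gamma>) w (\<lambda>t. \<gamma> t $ 3) \<alpha> T'"
      using periodic_billiard_imp_planar[OF bill T'] .
    then interpret B: periodic_planar_billiard "range \<tau>" "plane_proj \<circ> \<gamma>" w "\<lambda>t. \<gamma> t $ 3" \<alpha> T' .
    have "\<tau> 0 + T' \<in> range \<tau>" unfolding B.reflections_shift by blast
    then obtain j where j: "\<tau> 0 + T' = \<tau> j" by blast
    then have T'j: "T' = of_int j * L" by (simp add: \<tau>_def)
    then have "j > 0" using B.T_pos L by (simp add: zero_less_mult_iff)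
    have "\<gamma> (\<tau> j) = \<gamma> (\<tau> 0)" using T' j by (metis is_period_def)
    then have "e * \<rho>' powi j = e" using vertex[of j] vertex[of 0] by simp
    then have "cis (2 * pi * (of_int (m * j) / real n)) = 1" using e0 powi[of j] by simp
    then have "of_int (m * j) / real n \<in> \<int>" by (simp only: cis_2pi_eq_1_iff)
    then obtain q where "of_int (m * j) / real n = of_int q" by (elim Ints_cases)
    then have "of_int (m * j) = of_int q * real n" using n by (simp add: field_simps)
    then have "m * j = q * int n" by (metis of_int_eq_iff of_int_mult of_int_of_nat_eq)
    then have "int n dvd m * j" by simp
    then have "int n dvd j" using cop by (simp add: coprime_dvd_mult_right_iff coprime_commute)
    then have "int n \<le> j" using \<open>j > 0\<close> by (rule zdvd_imp_le)
    then have "real n \<le> of_int j" by linarith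
    then show ?thesis unfolding T'j using L by (intro mult_right_mono) auto
  qed
  have circ: "circular_segment (plane_proj \<circ> \<gamma>) (\<tau> k) (\<tau> (k + 1))" for k
    unfolding circular_segment_def
  proof (intro exI conjI ballI)
    show "norm (e * \<rho>' powi k * u) = 1" unfolding powi by (simp add: norm_mult ne u)
    fix x assume x: "x \<in> {\<tau> k..\<tau> (k + 1)}"
    have "((\<lambda>x. e * \<rho>' powi k * (1 + u * unit_arc a (x - \<tau> k))) has_vector_derivative
        e * \<rho>' powi k * (0 + u * cis (a * (x - \<tau> k)))) (at x within {\<tau> k..\<tau> (k + 1)})"
      by (intro derivative_intros has_vector_derivative_mult_right has_vector_derivative_arc)
    then have "(plane_proj \<circ> \<gamma> has_vector_derivative e * \<rho>' powi k * (0 + u * cis (a * (x - \<tau> k)))) (at x within {\<tau> k..\<tau> (k + 1)})"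
      by (rule has_vector_derivative_transform[rotated 2]) (use x seg in auto)
    then show "(plane_proj \<circ> \<gamma> has_vector_derivative e * \<rho>' powi k * u * cis (a * (x - \<tau> k))) (at x within {\<tau> k..\<tau> (k + 1)})"
      by (simp add: mult.assoc)
  qed
  show ?thesis
    unfolding ngon_trajectory_def
  proof (intro exI[of _ \<tau>] exI[of _ "real n * L"] conjI allI)
    show "strict_mono \<tau>" using L by (auto simp: strict_mono_def \<tau>_def)
    show "is_minimal_period \<gamma> (real n * L)" using period minimal by (simp add: is_minimal_period_def)
    fix k
    show "\<tau> (k + int n) = \<tau> k + real n * L" by (simp add: \<tau>_def algebra_simps)
    show "plane_proj (\<gamma> (\<tau> k)) \<in> P"
      unfolding vertex powi by (rule inscribed_regular_ngon_rotate[OF P e n])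
    show "plane_proj (\<gamma> (\<tau> (k + 1))) = cis (2 * pi * of_int m / real n) * plane_proj (\<gamma> (\<tau> k))"
      unfolding vertex \<rho>[symmetric] \<rho>'_def[symmetric]
      using chord_end_nonzero[OF chord] by (simp add: power_int_add \<rho>'_def)
  qed (use bill circ in auto)
qed

theorem no_interior_periodic_billiard:
  assumes "periodic_billiard_trajectory std_cylinder \<gamma>"
  shows "\<not> range \<gamma> \<subseteq> interior std_cylinder"
proof
  assume int: "range \<gamma> \<subseteq> interior std_cylinder"
  obtain R T where R: "billiard_trajectory_with std_cylinder R \<gamma>" and T: "is_period \<gamma> T"
    using assms by (auto simp: periodic_billiard_trajectory_def billiard_trajectory_def)
  obtain w \<alpha> where "periodic_planar_billiard R (plane_proj \<circ> \<gamma>) w (\<lambda>t. \<gamma> t $ 3) \<alpha> T"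
    using periodic_billiard_imp_planar[OF R T] .
  then interpret periodic_planar_billiard R "plane_proj \<circ> \<gamma>" w "\<lambda>t. \<gamma> t $ 3" \<alpha> T .
  obtain r where "r \<in> R" using reflections_exist by blast
  then have "norm (plane_proj (\<gamma> r)) = 1" using reflect by auto
  moreover have "\<gamma> r \<in> interior std_cylinder" using int by blast
  ultimately show False by (simp add: interior_std_cylinder)
qed

theorem periodic_billiard_ngon:
  assumes "periodic_billiard_trajectory std_cylinder \<gamma>"
  shows "\<exists>n P m. n \<ge> 2 \<and> inscribed_regular_ngon n P \<and> coprime m (int n) \<and> ngon_trajectory n P m \<gamma>"
proof -
  obtain R T where R: "billiard_trajectory_with std_cylinder R \<gamma>" and T: "is_period \<gamma> T"
    using assms by (auto simp: periodic_billiard_trajectory_def billiard_trajectory_def)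
  obtain w \<alpha> where "periodic_planar_billiard R (plane_proj \<circ> \<gamma>) w (\<lambda>t. \<gamma> t $ 3) \<alpha> T"
    using periodic_billiard_imp_planar[OF R T] .
  then interpret periodic_planar_billiard R "plane_proj \<circ> \<gamma>" w "\<lambda>t. \<gamma> t $ 3" \<alpha> T .
  obtain r where r: "r \<in> R" using reflections_exist by blast
  obtain a u L N where orb: "chord a u L" "Im (u * unit_arc a L) + arc_lift a L = 0"
    "N > 0" "(1 + u * unit_arc a L) ^ N = 1" "R = range (\<lambda>k::int. r + of_int k * L)"
    "\<forall>t. (plane_proj \<circ> \<gamma>) (r + t) = (plane_proj \<circ> \<gamma>) r * orbit_plane a u L t \<and>
       \<gamma> (r + t) $ 3 = \<gamma> r $ 3 + orbit_height a u L t"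
    using orbit_structure[OF r] by (elim exE conjE)
  obtain n m where nm: "n \<ge> 2" "coprime m (int n)" "1 + u * unit_arc a L = cis (2 * pi * of_int m / real n)"
    using root_of_unity_primitive[OF orb(4) orb(3) chord_end_neq_1[OF orb(1)]] .
  define e where "e = plane_proj (\<gamma> r)"
  \<comment> \<open>The polygon is built around the given vertex, so that \<open>e\<close> is the
    vertex with index 0.\<close>
  define P where "P = (\<lambda>k. e * cis (2 * pi * real k / real n)) ` {..<n}"
  have "norm e = 1" using reflect[OF r] by (simp add: e_def)
  then have P: "inscribed_regular_ngon n P" by (auto simp: inscribed_regular_ngon_def P_def)
  have "e = e * cis (2 * pi * real 0 / real n)" by simp
  then have eP: "e \<in> P" using nm(1) unfolding P_def by (intro image_eqI[of _ _ 0]) auto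
  have "ngon_trajectory n P m \<gamma>"
    by (rule orbit_ngon_trajectory[OF R[unfolded orb(5)] orb(1,2) _ _ nm(3) _ nm(2) P eP])
      (use orb(6) nm(1) in \<open>auto simp: e_def\<close>)
  then show ?thesis using nm P by blast
qed

text \<open>For two competitors \<open>zero_area_chord_unique\<close> leaves only the initial vertex
  and the initial height free. Because \<open>m\<close> is coprime to \<open>n\<close>, the orbit
  visits all vertices, so a difference in the initial vertex is a time shift.\<close>

theorem ngon_billiard_exists_unique:
  assumes n: "n \<ge> 2" and P: "inscribed_regular_ngon n P" and cop: "coprime m (int n)"
  shows "\<exists>\<gamma>. periodic_billiard_trajectory std_cylinder \<gamma> \<and> ngon_trajectory n P m \<gamma> \<and>
         (\<forall>\<delta>. periodic_billiard_trajectory std_cylinder \<delta> \<and> ngon_trajectory n P m \<delta> \<longrightarrow>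
            same_up_to_z_translation_and_shift \<gamma> \<delta>)"
proof -
  have n0: "n > 0" using n by simp
  define i where "i = m mod int n"
  have "\<not> int n dvd m"
  proof
    assume "int n dvd m"
    then have "int n dvd 1" using cop by (metis coprime_common_divisor dvd_refl)
    then show False using n by simp
  qed
  then have "i \<noteq> 0" by (simp add: i_def dvd_eq_mod_eq_0)
  moreover have "0 \<le> i" "i < int n" using n0 by (simp_all add: i_def)
  ultimately have i: "0 < i" "i < int n" by linarith+
  \<comment> \<open>Half the central angle. Only the residue of \<open>m\<close> matters, and it is
    nonzero because \<open>m\<close> is coprime to \<open>n \<ge> 2\<close>, so \<theta> lies
    strictly between 0 and \<open>pi\<close>.\<close>
  define \<theta> where "\<theta> = pi * of_int i / real n"
  have \<theta>: "0 < \<theta>" "\<theta> < pi" using i n0 by (simp_all add: \<theta>_def field_simps)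
  have "m = i + (m div int n) * int n" by (simp add: i_def)
  then have mi: "of_int m = of_int i + of_int (m div int n) * real n"
    by (metis of_int_add of_int_mult of_int_of_nat_eq)
  have "2 * pi * of_int m / real n = 2 * \<theta> + 2 * pi * of_int (m div int n)"
    unfolding mi using n0 by (simp add: \<theta>_def field_simps)
  then have cis_m: "cis (2 * pi * of_int m / real n) = cis (2 * \<theta>)"
    using cis_2pi_eq_1_iff[of "of_int (m div int n)"] by (simp flip: cis_mult)
  obtain a u L where chord: "chord a u L" "1 + u * unit_arc a L = cis (2 * \<theta>)"
    and area: "Im (u * unit_arc a L) + arc_lift a L = 0"
    using zero_area_chord_exists[OF \<theta>] .
  have L: "L > 0" using chord by (simp add: chord_def)
  obtain e where e: "e \<in> P" using P n0 by (auto simp: inscribed_regular_ngon_def)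
  have ne: "norm e = 1" using norm_inscribed_regular_ngon[OF P e] .
  define \<gamma> :: "real \<Rightarrow> real^3" where
    "\<gamma> t = vector [Re (e * orbit_plane a u L t), Im (e * orbit_plane a u L t), orbit_height a u L t]" for t
  have plane: "plane_proj (\<gamma> t) = e * orbit_plane a u L t" and height: "\<gamma> t $ 3 = orbit_height a u L t" for t
    by (simp_all only: \<gamma>_def plane_proj_def vector_3 complex_surj)
  have bill: "billiard_trajectory_with std_cylinder (range (\<lambda>k::int. of_int k * L)) \<gamma>"
    using orbit_planar_billiard[OF chord(1) area ne, of 0]
    by (intro planar_imp_billiard_trajectory) (simp add: o_def plane height)
  have ngon: "ngon_trajectory n P m \<gamma>"
    by (rule orbit_ngon_trajectory[where r = 0 and h = 0, OF _ chord(1) area _ _ _ n0 cop P e])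
      (simp_all add: bill plane height chord(2) cis_m)
  then have "periodic_billiard_trajectory std_cylinder \<gamma>"
    using bill by (auto simp: periodic_billiard_trajectory_def billiard_trajectory_def
        ngon_trajectory_def is_minimal_period_def)
  moreover have "same_up_to_z_translation_and_shift \<gamma> \<delta>" if \<delta>: "ngon_trajectory n P m \<delta>" for \<delta>
  proof -
    obtain \<tau> :: "int \<Rightarrow> real" and T where \<tau>: "strict_mono \<tau>" "billiard_trajectory_with std_cylinder (range \<tau>) \<delta>"
      "is_period \<delta> T" "\<And>k. plane_proj (\<delta> (\<tau> k)) \<in> P"
      "\<And>k. plane_proj (\<delta> (\<tau> (k + 1))) = cis (2 * pi * of_int m / real n) * plane_proj (\<delta> (\<tau> k))"
      using \<delta> unfolding ngon_trajectory_def is_minimal_period_def by blast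
    obtain w \<alpha> where "periodic_planar_billiard (range \<tau>) (plane_proj \<circ> \<delta>) w (\<lambda>t. \<delta> t $ 3) \<alpha> T"
      using periodic_billiard_imp_planar[OF \<tau>(2,3)] .
    then interpret periodic_planar_billiard "range \<tau>" "plane_proj \<circ> \<delta>" w "\<lambda>t. \<delta> t $ 3" \<alpha> T .
    have r: "\<tau> 0 \<in> range \<tau>" by blast
    obtain a' u' L' N where orb: "chord a' u' L'" "Im (u' * unit_arc a' L') + arc_lift a' L' = 0"
      "N > 0" "(1 + u' * unit_arc a' L') ^ N = 1"
      "range \<tau> = range (\<lambda>k::int. \<tau> 0 + of_int k * L')"
      "\<forall>t. (plane_proj \<circ> \<delta>) (\<tau> 0 + t) = (plane_proj \<circ> \<delta>) (\<tau> 0) * orbit_plane a' u' L' t \<and>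
        \<delta> (\<tau> 0 + t) $ 3 = \<delta> (\<tau> 0) $ 3 + orbit_height a' u' L' t"
      using orbit_structure[OF r] by (elim exE conjE)
    then have orb3: "range \<tau> = range (\<lambda>k::int. \<tau> 0 + of_int k * L')"
      and orb4: "plane_proj (\<delta> (\<tau> 0 + t)) = plane_proj (\<delta> (\<tau> 0)) * orbit_plane a' u' L' t"
      and orb5: "\<delta> (\<tau> 0 + t) $ 3 = \<delta> (\<tau> 0) $ 3 + orbit_height a' u' L' t" for t
      by auto
    have L': "L' > 0" using orb(1) by (simp add: chord_def)
    \<comment> \<open>\<open>orbit_structure\<close> describes the reflection times only as a set;
      monotonicity of the enumeration identifies the first one after
      \<open>\<tau> 0\<close>.\<close>
    have "\<tau> 1 = \<tau> 0 + L'"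
    proof -
      have "\<tau> 0 + of_int 1 * L' \<in> range \<tau>" unfolding orb3 by blast
      then obtain j where j: "\<tau> j = \<tau> 0 + L'" by auto
      then have "j > 0" using L' strict_mono_less[OF \<tau>(1), of 0 j] by simp
      then have le: "\<tau> 1 \<le> \<tau> 0 + L'" using j strict_mono_less_eq[OF \<tau>(1), of 1 j] by simp
      have "\<tau> 1 \<in> range (\<lambda>k::int. \<tau> 0 + of_int k * L')" unfolding orb3[symmetric] by blast
      then obtain k :: int where k: "\<tau> 1 = \<tau> 0 + of_int k * L'" by blast
      moreover have "\<tau> 0 < \<tau> 1" using \<tau>(1) by (simp add: strict_mono_less)
      ultimately have "k \<ge> 1" using L' by (simp add: zero_less_mult_iff)
      then have "of_int 1 * L' \<le> of_int k * L'" using L' by (intro mult_right_mono) auto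
      then show ?thesis using k le by simp
    qed
    define e' where "e' = plane_proj (\<delta> (\<tau> 0))"
    have e': "e' \<in> P" using \<tau>(4) by (simp add: e'_def)
    then have "e' \<noteq> 0" using norm_inscribed_regular_ngon[OF P] by force
    moreover have "cis (2 * \<theta>) * e' = e' * (1 + u' * unit_arc a' L')"
      using \<tau>(5)[of 0] orb4[of "0 + of_int 1 * L'"] \<open>\<tau> 1 = \<tau> 0 + L'\<close>
      unfolding orbit_plane_shift[OF orb(1)] cis_m by (simp add: e'_def)
    ultimately have "1 + u' * unit_arc a' L' = cis (2 * \<theta>)" by simp
    from zero_area_chord_unique[OF chord area orb(1) this orb(2) \<theta>]
    have eq: "a' = a" "u' = u" "L' = L" by auto
    obtain d where d: "e' = e * cis (2 * pi * of_int d / real n)"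
      using inscribed_regular_ngon_difference[OF P e e' n0] .
    \<comment> \<open>Bezout makes \<open>x\<close> an inverse of \<open>m\<close> modulo
      \<open>n\<close>. The rotation by \<open>d / n\<close> of a turn from \<open>e\<close> to
      \<open>e'\<close> is thus the effect of \<open>d * x\<close> arcs, that is, of a shift by
      \<open>d * x * L\<close>.\<close>
    obtain x y where "x * m + y * int n = 1" using cop bezout_int[of m "int n"] by (auto simp: coprime_iff_gcd_eq_1)
    then have "d * (x * m + y * int n) = d" by simp
    then have "d = m * (d * x) + d * y * int n" by (simp add: algebra_simps)
    then have "of_int d = of_int (m * (d * x)) + of_int (d * y) * real n" by (metis of_int_add of_int_mult of_int_of_nat_eq)
    then have "2 * pi * of_int d / real n = 2 * pi * (of_int (m * (d * x)) + of_int (d * y) * real n) / real n"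
      by (simp only:)
    also have "\<dots> = 2 * pi * of_int (m * (d * x)) / real n + 2 * pi * of_int (d * y)"
      using n0 by (simp only: add_divide_distrib distrib_left) simp
    finally have "2 * pi * of_int d / real n = 2 * pi * of_int (m * (d * x)) / real n + 2 * pi * of_int (d * y)" .
    then have "cis (2 * pi * of_int d / real n) = cis (2 * pi * of_int (m * (d * x)) / real n)"
      using cis_2pi_eq_1_iff[of "of_int (d * y)"] by (simp flip: cis_mult)
    also have "\<dots> = (1 + u * unit_arc a L) powi (d * x)"
      unfolding chord(2) cis_m[symmetric] by (rule cis_2pi_int_mult[symmetric])
    finally have e'_eq: "e' = e * (1 + u * unit_arc a L) powi (d * x)" using d by simp
    have "\<delta> t = \<gamma> (t + (of_int (d * x) * L - \<tau> 0)) + \<delta> (\<tau> 0) $ 3 *\<^sub>R axis 3 1" for t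
    proof (rule real3_eqI)
      have t: "t + (of_int (d * x) * L - \<tau> 0) = (t - \<tau> 0) + of_int (d * x) * L" by simp
      have add: "plane_proj (q + s *\<^sub>R axis 3 1) = plane_proj q" for q s
        by (simp add: plane_proj_def axis_def)
      show "plane_proj (\<delta> t) = plane_proj (\<gamma> (t + (of_int (d * x) * L - \<tau> 0)) + \<delta> (\<tau> 0) $ 3 *\<^sub>R axis 3 1)"
        unfolding add t plane orbit_plane_shift[OF chord(1)]
        using orb4[of "t - \<tau> 0"] by (simp add: eq e'_eq e'_def[symmetric] mult.assoc)
      show "\<delta> t $ 3 = (\<gamma> (t + (of_int (d * x) * L - \<tau> 0)) + \<delta> (\<tau> 0) $ 3 *\<^sub>R axis 3 1) $ 3"
        unfolding t vector_add_component height orbit_height_shift[OF chord(1)]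
        using orb5[of "t - \<tau> 0"] by (simp add: eq)
    qed
    then show ?thesis unfolding same_up_to_z_translation_and_shift_def by blast
  qed
  ultimately show ?thesis using ngon by blast
qed

theorem proposition5p15:
  "(\<nexists>\<gamma>. periodic_billiard_trajectory std_cylinder \<gamma> \<and> range \<gamma> \<subseteq> interior std_cylinder) \<and>
   (\<forall>\<gamma>. periodic_billiard_trajectory std_cylinder \<gamma> \<longrightarrow>
      (\<exists>n P m. n \<ge> 2 \<and> inscribed_regular_ngon n P \<and> coprime m (int n) \<and>
         ngon_trajectory n P m \<gamma>)) \<and>
   (\<forall>n P m. n \<ge> 2 \<and> inscribed_regular_ngon n P \<and> coprime m (int n) \<longrightarrow>
      (\<exists>\<gamma>. periodic_billiard_trajectory std_cylinder \<gamma> \<and> ngon_trajectory n P m \<gamma> \<and>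
         (\<forall>\<delta>. periodic_billiard_trajectory std_cylinder \<delta> \<and> ngon_trajectory n P m \<delta> \<longrightarrow>
            same_up_to_z_translation_and_shift \<gamma> \<delta>)))"
  using no_interior_periodic_billiard periodic_billiard_ngon ngon_billiard_exists_unique
  by blast

end
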